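(* Let $\varphi : R \to S$ be a homomorphism of commutative rings. Let $L$ be an $R$-module and let $M$ be an $S$-module that is flat as an $R$-module (via $\varphi$). Assume that $R$ is Noetherian and that $L$ is finitely generated over $R$. Then \[ \mathrm{sK}_S(L \otimes_R M) = \bigcup_{\mathfrak{p} \in \mathrm{Ass}_R(L)} \mathrm{sK}_S(M/\mathfrak{p} M). \]
   Context: All rings are commutative with unity; $S$ is not necessarily Noetherian. For a ring $A$ and an $A$-module $N$, the set $\mathrm{sK}_A(N)$ of strong Krull primes of $N$ is the set of all $\mathfrak{p} \in \mathrm{Spec}\, A$ such that for every finitely generated ideal $I$ of $A$ with $I \subseteq \mathfrak{p}$ there is an element $z \in N$ with $I \subseteq \mathrm{ann}_A(z) \subseteq \mathfrak{p}$. $\mathrm{Ass}_R(L)$ denotes the set of associated primes of $L$, i.e. primes of the form $\mathrm{ann}_R(z)$ with $z \in L$. The $S$-module structure on $L \otimes_R M$ is via the factor $M$. *)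

theory Defs
  imports "HOL-Algebra.Module" "HOL-Algebra.Free_Abelian_Groups" "HOL-Algebra.Ring_Divisibility"
begin

definition module_of_group :: "('b, 'm) monoid_scheme \<Rightarrow> ('a \<Rightarrow> 'b \<Rightarrow> 'b) \<Rightarrow> ('a, 'b) module"
  \<comment> \<open>the fields \<open>mult\<close> and \<open>one\<close> of a module record are irrelevant to the locale \<open>module\<close>\<close>
  where "module_of_group G sm =
    \<lparr>carrier = carrier G, monoid.mult = undefined, one = undefined,
     ring.zero = \<one>\<^bsub>G\<^esub>, ring.add = (\<otimes>\<^bsub>G\<^esub>), smult = sm\<rparr>"

definition restrict_scalars :: "('r \<Rightarrow> 's) \<Rightarrow> ('s, 'm, 'c) module_scheme \<Rightarrow> ('r, 'm) module"
  where "restrict_scalars \<phi> M = module_of_group (add_monoid M) (\<lambda>r x. \<phi> r \<odot>\<^bsub>M\<^esub> x)"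

definition linear_maps ::
    "('r, 'c) ring_scheme \<Rightarrow> ('r, 'a, 'd) module_scheme \<Rightarrow> ('r, 'b, 'e) module_scheme \<Rightarrow> ('a \<Rightarrow> 'b) set"
  where "linear_maps R N N' =
    {f \<in> hom (add_monoid N) (add_monoid N').
       \<forall>r\<in>carrier R. \<forall>x\<in>carrier N. f (r \<odot>\<^bsub>N\<^esub> x) = r \<odot>\<^bsub>N'\<^esub> f x}"

definition fg_module :: "('r, 'c) ring_scheme \<Rightarrow> ('r, 'a, 'd) module_scheme \<Rightarrow> bool"
  where "fg_module R L \<longleftrightarrow> module R L \<and>
    (\<exists>B. finite B \<and> B \<subseteq> carrier L \<and>
      (\<forall>x\<in>carrier L. \<exists>c\<in>B \<rightarrow> carrier R. x = (\<Oplus>\<^bsub>L\<^esub>b\<in>B. c b \<odot>\<^bsub>L\<^esub> b)))"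

definition fg_ideal :: "'a set \<Rightarrow> ('a, 'c) ring_scheme \<Rightarrow> bool"
  where "fg_ideal I A \<longleftrightarrow> (\<exists>B. finite B \<and> B \<subseteq> carrier A \<and> I = Idl\<^bsub>A\<^esub> B)"

definition ann :: "('a, 'c) ring_scheme \<Rightarrow> ('a, 'b, 'd) module_scheme \<Rightarrow> 'b \<Rightarrow> 'a set"
  where "ann A N z = {a \<in> carrier A. a \<odot>\<^bsub>N\<^esub> z = \<zero>\<^bsub>N\<^esub>}"

definition Ass :: "('a, 'c) ring_scheme \<Rightarrow> ('a, 'b, 'd) module_scheme \<Rightarrow> 'a set set"
  where "Ass A N = {\<pp>. primeideal \<pp> A \<and> (\<exists>z\<in>carrier N. \<pp> = ann A N z)}"

definition sK :: "('a, 'c) ring_scheme \<Rightarrow> ('a, 'b, 'd) module_scheme \<Rightarrow> 'a set set"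
  where "sK A N = {\<pp>. primeideal \<pp> A \<and>
    (\<forall>I. fg_ideal I A \<and> I \<subseteq> \<pp> \<longrightarrow> (\<exists>z\<in>carrier N. I \<subseteq> ann A N z \<and> ann A N z \<subseteq> \<pp>))}"

definition ideal_smult :: "'r set \<Rightarrow> ('r, 'm, 'd) module_scheme \<Rightarrow> 'm set"
  where "ideal_smult I M = generate (add_monoid M) {a \<odot>\<^bsub>M\<^esub> x | a x. a \<in> I \<and> x \<in> carrier M}"

definition quotient_module :: "('s, 'm, 'd) module_scheme \<Rightarrow> 'm set \<Rightarrow> ('s, 'm set) module"
  where "quotient_module M N =
    module_of_group (M A_Mod N) (\<lambda>a C. \<Union>x\<in>C. N +>\<^bsub>M\<^esub> (a \<odot>\<^bsub>M\<^esub> x))"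

text \<open>The tensor product of the \<open>R\<close>-modules \<open>L\<close> and \<open>N\<close>: the free abelian group on
  \<open>carrier L \<times> carrier N\<close> modulo the subgroup generated by the usual relations.\<close>

definition tensor_relations ::
    "('r, 'c) ring_scheme \<Rightarrow> ('r, 'l, 'd) module_scheme \<Rightarrow> ('r, 'n, 'e) module_scheme
      \<Rightarrow> ('l \<times> 'n \<Rightarrow>\<^sub>0 int) set"
  where "tensor_relations R L N =
    {frag_of (x \<oplus>\<^bsub>L\<^esub> x', y) - frag_of (x, y) - frag_of (x', y) | x x' y.
       x \<in> carrier L \<and> x' \<in> carrier L \<and> y \<in> carrier N} \<union>
    {frag_of (x, y \<oplus>\<^bsub>N\<^esub> y') - frag_of (x, y) - frag_of (x, y') | x y y'.
       x \<in> carrier L \<and> y \<in> carrier N \<and> y' \<in> carrier N} \<union>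
    {frag_of (r \<odot>\<^bsub>L\<^esub> x, y) - frag_of (x, r \<odot>\<^bsub>N\<^esub> y) | r x y.
       r \<in> carrier R \<and> x \<in> carrier L \<and> y \<in> carrier N}"

definition tensor_kernel ::
    "('r, 'c) ring_scheme \<Rightarrow> ('r, 'l, 'd) module_scheme \<Rightarrow> ('r, 'n, 'e) module_scheme
      \<Rightarrow> ('l \<times> 'n \<Rightarrow>\<^sub>0 int) set"
  where "tensor_kernel R L N =
    generate (free_Abelian_group (carrier L \<times> carrier N)) (tensor_relations R L N)"

definition tensor_group ::
    "('r, 'c) ring_scheme \<Rightarrow> ('r, 'l, 'd) module_scheme \<Rightarrow> ('r, 'n, 'e) module_scheme
      \<Rightarrow> ('l \<times> 'n \<Rightarrow>\<^sub>0 int) set monoid"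
  where "tensor_group R L N =
    free_Abelian_group (carrier L \<times> carrier N) Mod tensor_kernel R L N"

text \<open>The map of cosets \<open>L \<otimes> N \<rightarrow> L' \<otimes> N'\<close> induced by \<open>x \<otimes> y \<mapsto> f x \<otimes> g y\<close>, for additive
  \<open>f : L \<rightarrow> L'\<close> and \<open>g : N \<rightarrow> N'\<close> that are \<open>R\<close>-linear.\<close>

definition tensor_map ::
    "('r, 'c) ring_scheme \<Rightarrow> ('r, 'l, 'd) module_scheme \<Rightarrow> ('r, 'n, 'e) module_scheme
      \<Rightarrow> ('k \<Rightarrow> 'l) \<Rightarrow> ('m \<Rightarrow> 'n) \<Rightarrow> ('k \<times> 'm \<Rightarrow>\<^sub>0 int) set \<Rightarrow> ('l \<times> 'n \<Rightarrow>\<^sub>0 int) set"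
  where "tensor_map R L' N' f g C =
    (\<Union>c\<in>C. tensor_kernel R L' N' #>\<^bsub>free_Abelian_group (carrier L' \<times> carrier N')\<^esub>
              frag_extend (\<lambda>(x, y). frag_of (f x, g y)) c)"

text \<open>\<open>L \<otimes>\<^sub>R M\<close> for an \<open>R\<close>-module \<open>L\<close> and an \<open>S\<close>-module \<open>M\<close>, as an \<open>S\<close>-module via \<open>M\<close>.\<close>

definition tensor_module ::
    "('r, 'c) ring_scheme \<Rightarrow> ('r \<Rightarrow> 's) \<Rightarrow> ('r, 'l, 'd) module_scheme \<Rightarrow> ('s, 'm, 'e) module_scheme
      \<Rightarrow> ('s, ('l \<times> 'm \<Rightarrow>\<^sub>0 int) set) module"
  where "tensor_module R \<phi> L M =
    module_of_group (tensor_group R L (restrict_scalars \<phi> M))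
      (\<lambda>s. tensor_map R L (restrict_scalars \<phi> M) (\<lambda>x. x) (\<lambda>y. s \<odot>\<^bsub>M\<^esub> y))"

text \<open>A definition cannot quantify over modules of all types, so the test modules \<open>N\<close>, \<open>N'\<close>
  have their carriers in the type \<open>'r list set\<close>.  This loses nothing.  A module generated by
  \<open>g\<^sub>1, \<dots>, g\<^sub>n\<close> has an isomorphic copy there: represent \<open>x\<close> by the set of lists
  \<open>[c\<^sub>1, \<dots>, c\<^sub>n]\<close> with \<open>x = c\<^sub>1 g\<^sub>1 + \<dots> + c\<^sub>n g\<^sub>n\<close>.  And for arbitrary modules \<open>N \<subseteq> N'\<close>, an
  element of the kernel of \<open>N \<otimes> M \<rightarrow> N' \<otimes> M\<close> and the relations that make it vanish in
  \<open>N' \<otimes> M\<close> only involve finitely generated submodules of \<open>N\<close> and \<open>N'\<close>.\<close>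

definition flat_module :: "('r, 'c) ring_scheme \<Rightarrow> ('r, 'm, 'd) module_scheme \<Rightarrow> bool"
  where "flat_module R M \<longleftrightarrow> module R M \<and>
    (\<forall>(N :: ('r, 'r list set) module) (N' :: ('r, 'r list set) module).
       \<forall>f\<in>linear_maps R N N'. module R N \<and> module R N' \<and> inj_on f (carrier N) \<longrightarrow>
         inj_on (tensor_map R N' M f (\<lambda>y. y)) (carrier (tensor_group R N M)))"

end

theory Submission
  imports Defs "HOL-Algebra.QuotRing"
begin

text \<open>
  Let \<open>P\<close> be a strong Krull prime of \<open>L \<otimes> M\<close> and \<open>\<qq> = \<phi>\<^sup>-\<^sup>1(P)\<close>, which is finitely generated. Adding
  \<open>\<phi>(\<qq>)\<close> to the finitely generated ideals \<open>I \<subseteq> P\<close>, we may test with elements \<open>z\<close> that are killed by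
  \<open>\<phi>(\<qq>)\<close>. By the equational criterion of flatness such a \<open>z\<close> equals \<open>\<Sum>j. x j \<otimes> y j\<close> with all \<open>x j\<close>
  killed by \<open>\<qq>\<close>. Multiplication by elements outside \<open>P\<close> affects neither \<open>I \<subseteq> ann z\<close> nor
  \<open>ann z \<subseteq> P\<close> and makes the \<open>x j\<close> linearly independent over \<open>R/\<qq>\<close>. Then \<open>ann z\<close> is the
  intersection of the annihilators of the \<open>y j\<close> in \<open>M/\<qq>M\<close>, one of which lies in \<open>P\<close>, and
  \<open>\<qq> = ann (x j)\<close> is associated to \<open>L\<close>. Conversely, if \<open>\<pp> = ann x\<close>, flatness shows that \<open>x \<otimes> m\<close>
  and the class of \<open>m\<close> in \<open>M/\<pp>M\<close> have the same annihilator.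
\<close>

section \<open>Tensor products through formal sums\<close>

text \<open>The multiplications by elements outside \<open>P\<close> stand in for localization at
  \<open>P\<close>. After localizing, a tensor killed by \<open>\<qq>\<close> would live over the
  residue field of \<open>\<qq>\<close>, where a basis could be chosen; here dependent
  \<open>x j\<close> are eliminated one at a time, without forming any fractions. Enlarging
  \<open>I\<close> by \<open>\<phi>(\<qq>)\<close> is legitimate only because \<open>\<qq>\<close>
  is finitely generated: \<open>sK\<close> offers test elements for finitely generated ideals alone.
  The obstacle is the form of flatness. It speaks only about test modules with carriers in
  \<open>'r list set\<close>, so it cannot be applied to \<open>L\<close> itself. Every use is
  therefore reduced to one kind of test, the inclusion of a finitely generated ideal into
  \<open>R\<close>. What this yields for \<open>L\<close> is extracted by matrix manipulations on
  the families of second components of tensors, the notion \<open>trivial_family\<close>.\<close>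

lemma keys_minus_subset:
  "\<lbrakk>Poly_Mapping.keys c \<subseteq> A; Poly_Mapping.keys d \<subseteq> A\<rbrakk>
    \<Longrightarrow> Poly_Mapping.keys (c - d :: 'k \<Rightarrow>\<^sub>0 int) \<subseteq> A"
  using keys_diff[of c d] by blast

lemma tensor_relationsI:
  "\<lbrakk>x \<in> carrier L; x' \<in> carrier L; y \<in> carrier N\<rbrakk>
    \<Longrightarrow> frag_of (x \<oplus>\<^bsub>L\<^esub> x', y) - frag_of (x, y) - frag_of (x', y) \<in> tensor_relations R L N"
  "\<lbrakk>x \<in> carrier L; y \<in> carrier N; y' \<in> carrier N\<rbrakk>
    \<Longrightarrow> frag_of (x, y \<oplus>\<^bsub>N\<^esub> y') - frag_of (x, y) - frag_of (x, y') \<in> tensor_relations R L N"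
  "\<lbrakk>r \<in> carrier R; x \<in> carrier L; y \<in> carrier N\<rbrakk>
    \<Longrightarrow> frag_of (r \<odot>\<^bsub>L\<^esub> x, y) - frag_of (x, r \<odot>\<^bsub>N\<^esub> y) \<in> tensor_relations R L N"
  unfolding tensor_relations_def by blast+

lemma tensor_relationsE:
  assumes "c \<in> tensor_relations R L N"
  obtains (add_left) x x' y where "x \<in> carrier L" "x' \<in> carrier L" "y \<in> carrier N"
      "c = frag_of (x \<oplus>\<^bsub>L\<^esub> x', y) - frag_of (x, y) - frag_of (x', y)"
  | (add_right) x y y' where "x \<in> carrier L" "y \<in> carrier N" "y' \<in> carrier N"
      "c = frag_of (x, y \<oplus>\<^bsub>N\<^esub> y') - frag_of (x, y) - frag_of (x, y')"
  | (smult) r x y where "r \<in> carrier R" "x \<in> carrier L" "y \<in> carrier N"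
      "c = frag_of (r \<odot>\<^bsub>L\<^esub> x, y) - frag_of (x, r \<odot>\<^bsub>N\<^esub> y)"
  using assms unfolding tensor_relations_def by blast

locale tensor_pair = L: module R L + N: module R N
  for R :: "('r, 'a) ring_scheme" and L :: "('r, 'l, 'c) module_scheme"
    and N :: "('r, 'n, 'd) module_scheme"
begin

abbreviation free where "free \<equiv> free_Abelian_group (carrier L \<times> carrier N)"

abbreviation kernel where "kernel \<equiv> tensor_kernel R L N"

text \<open>Equality of tensors, expressed on representatives, so that cosets appear only at the
  interface with \<open>tensor_group\<close> and \<open>tensor_module\<close>. Neither side has to
  be supported on the carriers, which makes the relation a congruence for sums without side
  conditions.\<close>

definition teq :: "('l \<times> 'n \<Rightarrow>\<^sub>0 int) \<Rightarrow> ('l \<times> 'n \<Rightarrow>\<^sub>0 int) \<Rightarrow> bool" (infix \<open>\<doteq>\<close> 50)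
  where "c \<doteq> d \<longleftrightarrow> c - d \<in> kernel"

lemma keys_relation:
  assumes "c \<in> tensor_relations R L N"
  shows "Poly_Mapping.keys c \<subseteq> carrier L \<times> carrier N"
  using assms by (cases rule: tensor_relationsE) (simp_all add: keys_minus_subset)

lemma tensor_relations_subset: "tensor_relations R L N \<subseteq> carrier free"
  using keys_relation by (intro subsetI) (simp only: carrier_free_Abelian_group_iff)

lemma kernel_subgroup: "subgroup kernel free"
  unfolding tensor_kernel_def
  by (intro group.generate_is_subgroup tensor_relations_subset group_free_Abelian_group)

lemma kernel_keys: "c \<in> kernel \<Longrightarrow> Poly_Mapping.keys c \<subseteq> carrier L \<times> carrier N"
  using subgroup.mem_carrier[OF kernel_subgroup] by (simp only: carrier_free_Abelian_group_iff)

lemma kernel_zero: "0 \<in> kernel"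
  using subgroup.one_closed[OF kernel_subgroup] by simp

lemma kernel_add: "\<lbrakk>c \<in> kernel; d \<in> kernel\<rbrakk> \<Longrightarrow> c + d \<in> kernel"
  using subgroup.m_closed[OF kernel_subgroup, of c d] by simp

lemma kernel_uminus: "c \<in> kernel \<Longrightarrow> - c \<in> kernel"
  using subgroup.m_inv_closed[OF kernel_subgroup, of c] kernel_keys[of c] by simp

lemma kernel_diff: "\<lbrakk>c \<in> kernel; d \<in> kernel\<rbrakk> \<Longrightarrow> c - d \<in> kernel"
  using kernel_add[of c "- d"] kernel_uminus[of d] by simp

lemma kernel_induct [consumes 1, case_names zero relation add uminus]:
  assumes "c \<in> kernel"
    and "P 0"
    and "\<And>c. c \<in> tensor_relations R L N \<Longrightarrow> P c"
    and "\<And>c d. \<lbrakk>c \<in> kernel; d \<in> kernel; P c; P d\<rbrakk> \<Longrightarrow> P (c + d)"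
    and "\<And>c. \<lbrakk>c \<in> kernel; P c\<rbrakk> \<Longrightarrow> P (- c)"
  shows "P c"
  using assms(1) unfolding tensor_kernel_def
proof (induction rule: generate.induct)
  case one
  then show ?case using assms(2) by simp
next
  case (incl h)
  then show ?case using assms(3) by simp
next
  case (inv h)
  then have "Poly_Mapping.keys h \<subseteq> carrier L \<times> carrier N"
    by (rule keys_relation)
  moreover have "h \<in> kernel"
    using inv unfolding tensor_kernel_def by (rule generate.incl)
  ultimately show ?case
    using assms(3)[OF inv] assms(5) by simp
next
  case (eng h1 h2)
  then show ?case using assms(4) by (simp add: tensor_kernel_def)
qed

lemma teq_refl [simp]: "c \<doteq> c"
  by (simp add: teq_def kernel_zero)

lemma teq_sym: "c \<doteq> d \<Longrightarrow> d \<doteq> c"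
  using kernel_uminus[of "c - d"] by (simp add: teq_def)

lemma teq_trans [trans]: "\<lbrakk>c \<doteq> d; d \<doteq> e\<rbrakk> \<Longrightarrow> c \<doteq> e"
  using kernel_add[of "c - d" "d - e"] by (simp add: teq_def)

lemma teq_add: "\<lbrakk>c \<doteq> c'; d \<doteq> d'\<rbrakk> \<Longrightarrow> c + d \<doteq> c' + d'"
  using kernel_add[of "c - c'" "d - d'"] by (simp add: teq_def algebra_simps)

lemma teq_diff: "\<lbrakk>c \<doteq> c'; d \<doteq> d'\<rbrakk> \<Longrightarrow> c - d \<doteq> c' - d'"
  using kernel_diff[of "c - c'" "d - d'"] by (simp add: teq_def algebra_simps)

lemma teq_sum: "(\<And>j. j \<in> J \<Longrightarrow> f j \<doteq> g j) \<Longrightarrow> (\<Sum>j\<in>J. f j) \<doteq> (\<Sum>j\<in>J. g j)"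
  by (induction J rule: infinite_finite_induct) (auto intro: teq_add)

lemma teq_0_iff: "c \<doteq> 0 \<longleftrightarrow> c \<in> kernel"
  by (simp add: teq_def)

lemma kernel_cong: "c \<doteq> d \<Longrightarrow> c \<in> kernel \<longleftrightarrow> d \<in> kernel"
  using teq_trans teq_sym teq_0_iff by metis

lemma relation_in_kernel: "c \<in> tensor_relations R L N \<Longrightarrow> c \<in> kernel"
  unfolding tensor_kernel_def by (rule generate.incl)

lemma pure_add_left:
  assumes "x \<in> carrier L" "x' \<in> carrier L" "y \<in> carrier N"
  shows "frag_of (x \<oplus>\<^bsub>L\<^esub> x', y) \<doteq> frag_of (x, y) + frag_of (x', y)"
proof -
  have "frag_of (x \<oplus>\<^bsub>L\<^esub> x', y) - frag_of (x, y) - frag_of (x', y) \<in> kernel"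
    by (rule relation_in_kernel) (intro tensor_relationsI assms)
  then show ?thesis by (simp add: teq_def algebra_simps)
qed

lemma pure_add_right:
  assumes "x \<in> carrier L" "y \<in> carrier N" "y' \<in> carrier N"
  shows "frag_of (x, y \<oplus>\<^bsub>N\<^esub> y') \<doteq> frag_of (x, y) + frag_of (x, y')"
proof -
  have "frag_of (x, y \<oplus>\<^bsub>N\<^esub> y') - frag_of (x, y) - frag_of (x, y') \<in> kernel"
    by (rule relation_in_kernel) (intro tensor_relationsI assms)
  then show ?thesis by (simp add: teq_def algebra_simps)
qed

lemma pure_smult:
  assumes "r \<in> carrier R" "x \<in> carrier L" "y \<in> carrier N"
  shows "frag_of (r \<odot>\<^bsub>L\<^esub> x, y) \<doteq> frag_of (x, r \<odot>\<^bsub>N\<^esub> y)"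
  unfolding teq_def
  by (rule relation_in_kernel) (intro tensor_relationsI assms)

text \<open>For \<open>0 + 0 = 0\<close> the additivity relation collapses to the negative of the
  pure tensor in question.\<close>

lemma pure_zero_left: "y \<in> carrier N \<Longrightarrow> frag_of (\<zero>\<^bsub>L\<^esub>, y) \<doteq> 0"
  using pure_add_left[of "\<zero>\<^bsub>L\<^esub>" "\<zero>\<^bsub>L\<^esub>" y] kernel_uminus[of "- frag_of (\<zero>\<^bsub>L\<^esub>, y)"]
  by (simp add: teq_def)

lemma pure_zero_right: "x \<in> carrier L \<Longrightarrow> frag_of (x, \<zero>\<^bsub>N\<^esub>) \<doteq> 0"
  using pure_add_right[of x "\<zero>\<^bsub>N\<^esub>" "\<zero>\<^bsub>N\<^esub>"] kernel_uminus[of "- frag_of (x, \<zero>\<^bsub>N\<^esub>)"]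
  by (simp add: teq_def)

lemma pure_minus_right:
  assumes "x \<in> carrier L" "y \<in> carrier N"
  shows "frag_of (x, \<ominus>\<^bsub>N\<^esub> y) \<doteq> - frag_of (x, y)"
proof -
  have "0 \<doteq> frag_of (x, y \<oplus>\<^bsub>N\<^esub> \<ominus>\<^bsub>N\<^esub> y)"
    using assms by (simp add: N.M.r_neg teq_sym pure_zero_right)
  also have "\<dots> \<doteq> frag_of (x, y) + frag_of (x, \<ominus>\<^bsub>N\<^esub> y)"
    using assms by (intro pure_add_right) auto
  finally have "0 - frag_of (x, y) \<doteq> frag_of (x, y) + frag_of (x, \<ominus>\<^bsub>N\<^esub> y) - frag_of (x, y)"
    by (rule teq_diff) simp
  then show ?thesis by (simp add: teq_sym)
qed

lemma pure_sum_left: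
  assumes "finite J" "f \<in> J \<rightarrow> carrier L" "y \<in> carrier N"
  shows "frag_of (\<Oplus>\<^bsub>L\<^esub>j\<in>J. f j, y) \<doteq> (\<Sum>j\<in>J. frag_of (f j, y))"
  using assms(1,2)
proof (induction J rule: finite_induct)
  case empty
  then show ?case using assms(3) by (simp add: pure_zero_left)
next
  case (insert i J)
  then have "frag_of (\<Oplus>\<^bsub>L\<^esub>j\<in>insert i J. f j, y) = frag_of (f i \<oplus>\<^bsub>L\<^esub> (\<Oplus>\<^bsub>L\<^esub>j\<in>J. f j), y)"
    by (simp add: Pi_iff)
  also have "\<dots> \<doteq> frag_of (f i, y) + frag_of (\<Oplus>\<^bsub>L\<^esub>j\<in>J. f j, y)"
    using insert.prems assms(3) by (intro pure_add_left) auto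
  also have "\<dots> \<doteq> frag_of (f i, y) + (\<Sum>j\<in>J. frag_of (f j, y))"
    using insert.prems by (intro teq_add insert.IH teq_refl) auto
  finally show ?case using insert.hyps by simp
qed

lemma pure_sum_right:
  assumes "finite J" "f \<in> J \<rightarrow> carrier N" "x \<in> carrier L"
  shows "frag_of (x, \<Oplus>\<^bsub>N\<^esub>j\<in>J. f j) \<doteq> (\<Sum>j\<in>J. frag_of (x, f j))"
  using assms(1,2)
proof (induction J rule: finite_induct)
  case empty
  then show ?case using assms(3) by (simp add: pure_zero_right)
next
  case (insert i J)
  then have "frag_of (x, \<Oplus>\<^bsub>N\<^esub>j\<in>insert i J. f j) = frag_of (x, f i \<oplus>\<^bsub>N\<^esub> (\<Oplus>\<^bsub>N\<^esub>j\<in>J. f j))"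
    by (simp add: Pi_iff)
  also have "\<dots> \<doteq> frag_of (x, f i) + frag_of (x, \<Oplus>\<^bsub>N\<^esub>j\<in>J. f j)"
    using insert.prems assms(3) by (intro pure_add_right) auto
  also have "\<dots> \<doteq> frag_of (x, f i) + (\<Sum>j\<in>J. frag_of (x, f j))"
    using insert.prems by (intro teq_add insert.IH teq_refl) auto
  finally show ?case using insert.hyps by simp
qed

text \<open>The bridge between cosets and \<open>\<doteq>\<close>. The support conditions come from
  the coset lemmas, which speak about elements of the group \<open>free\<close> only.\<close>

lemma coset_eq_iff:
  assumes "Poly_Mapping.keys c \<subseteq> carrier L \<times> carrier N"
    and "Poly_Mapping.keys d \<subseteq> carrier L \<times> carrier N"
  shows "kernel #>\<^bsub>free\<^esub> c = kernel #>\<^bsub>free\<^esub> d \<longleftrightarrow> c \<doteq> d"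
proof
  assume "kernel #>\<^bsub>free\<^esub> c = kernel #>\<^bsub>free\<^esub> d"
  then have "c \<in> kernel #>\<^bsub>free\<^esub> d"
    using assms group.repr_independenceD[OF group_free_Abelian_group kernel_subgroup, of c d] by simp
  then show "c \<doteq> d" by (auto simp: r_coset_def teq_def)
next
  assume "c \<doteq> d"
  then have "c \<in> kernel #>\<^bsub>free\<^esub> d"
    by (auto simp: r_coset_def teq_def intro!: bexI[of _ "c - d"])
  then show "kernel #>\<^bsub>free\<^esub> c = kernel #>\<^bsub>free\<^esub> d"
    using assms group.repr_independence[OF group_free_Abelian_group _ _ kernel_subgroup] by fastforce
qed

lemma coset_eq_kernel_iff:
  assumes "Poly_Mapping.keys c \<subseteq> carrier L \<times> carrier N"
  shows "kernel #>\<^bsub>free\<^esub> c = kernel \<longleftrightarrow> c \<in> kernel"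
proof -
  have "kernel #>\<^bsub>free\<^esub> 0 = kernel"
    by (simp add: r_coset_def)
  then show ?thesis
    using coset_eq_iff[OF assms, of 0] by (simp add: teq_0_iff)
qed

end

section \<open>Induced maps of tensor products on representatives\<close>

definition frag_map :: "('k \<Rightarrow> 'l) \<Rightarrow> ('m \<Rightarrow> 'n) \<Rightarrow> ('k \<times> 'm \<Rightarrow>\<^sub>0 int) \<Rightarrow> ('l \<times> 'n \<Rightarrow>\<^sub>0 int)"
  where "frag_map f g = frag_extend (\<lambda>(x, y). frag_of (f x, g y))"

lemma frag_map_of [simp]: "frag_map f g (frag_of (x, y)) = frag_of (f x, g y)"
  by (simp add: frag_map_def)

lemma frag_map_simps [simp]:
  "frag_map f g 0 = 0"
  "frag_map f g (c + d) = frag_map f g c + frag_map f g d"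
  "frag_map f g (c - d) = frag_map f g c - frag_map f g d"
  "frag_map f g (- c) = - frag_map f g c"
  by (simp_all add: frag_map_def frag_extend_add frag_extend_diff frag_extend_minus)

lemma frag_map_sum: "frag_map f g (\<Sum>j\<in>J. h j) = (\<Sum>j\<in>J. frag_map f g (h j))"
  by (induction J rule: infinite_finite_induct) auto

lemma keys_frag_map:
  assumes "Poly_Mapping.keys c \<subseteq> A \<times> B" "f \<in> A \<rightarrow> A'" "g \<in> B \<rightarrow> B'"
  shows "Poly_Mapping.keys (frag_map f g c) \<subseteq> A' \<times> B'"
  using keys_frag_extend[of "\<lambda>(x, y). frag_of (f x, g y)" c] assms
  by (fastforce simp: frag_map_def)

lemma linear_mapsD:
  assumes "f \<in> linear_maps R N N'"
  shows "x \<in> carrier N \<Longrightarrow> f x \<in> carrier N'"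
    and "\<lbrakk>x \<in> carrier N; y \<in> carrier N\<rbrakk> \<Longrightarrow> f (x \<oplus>\<^bsub>N\<^esub> y) = f x \<oplus>\<^bsub>N'\<^esub> f y"
    and "\<lbrakk>r \<in> carrier R; x \<in> carrier N\<rbrakk> \<Longrightarrow> f (r \<odot>\<^bsub>N\<^esub> x) = r \<odot>\<^bsub>N'\<^esub> f x"
  using assms by (auto simp: linear_maps_def hom_def)

context
  fixes R :: "('r, 'a) ring_scheme" and L :: "('r, 'l, 'c) module_scheme"
    and N :: "('r, 'n, 'd) module_scheme" and L' :: "('r, 'l2, 'c2) module_scheme"
    and N' :: "('r, 'n2, 'd2) module_scheme" and f g
  assumes LN: "tensor_pair R L N" and LN': "tensor_pair R L' N'"
    and f: "f \<in> linear_maps R L L'" and g: "g \<in> linear_maps R N N'"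
begin

interpretation A: tensor_pair R L N by (rule LN)
interpretation B: tensor_pair R L' N' by (rule LN')

text \<open>Linear maps send each defining relation to a defining relation of the same kind.\<close>

lemma frag_map_kernel: "c \<in> A.kernel \<Longrightarrow> frag_map f g c \<in> B.kernel"
proof (induction rule: A.kernel_induct)
  case zero
  then show ?case by (simp add: B.kernel_zero)
next
  case (relation c)
  then have "frag_map f g c \<in> tensor_relations R L' N'"
    by (cases rule: tensor_relationsE)
      (simp_all add: linear_mapsD[OF f] linear_mapsD[OF g] tensor_relationsI)
  then show ?case by (rule B.relation_in_kernel)
next
  case (add c d)
  then show ?case by (simp add: B.kernel_add)
next
  case (uminus c)
  then show ?case by (simp add: B.kernel_uminus)
qed

text \<open>\<open>tensor_map\<close> is a union over all representatives of a coset. By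
  \<open>frag_map_kernel\<close> all of them contribute the same coset, and \<open>c\<close> itself
  shows that the union is not empty.\<close>

lemma tensor_map_coset:
  assumes "Poly_Mapping.keys c \<subseteq> carrier L \<times> carrier N"
  shows "tensor_map R L' N' f g (A.kernel #>\<^bsub>A.free\<^esub> c) = B.kernel #>\<^bsub>B.free\<^esub> frag_map f g c"
proof -
  have keys: "Poly_Mapping.keys (frag_map f g d) \<subseteq> carrier L' \<times> carrier N'"
    if "Poly_Mapping.keys d \<subseteq> carrier L \<times> carrier N" for d
    using that linear_mapsD(1)[OF f] linear_mapsD(1)[OF g] by (intro keys_frag_map) auto
  have "B.kernel #>\<^bsub>B.free\<^esub> frag_map f g d = B.kernel #>\<^bsub>B.free\<^esub> frag_map f g c"
    if d: "d \<in> A.kernel #>\<^bsub>A.free\<^esub> c" for d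
  proof -
    obtain k where k: "k \<in> A.kernel" "d = k + c"
      using d by (auto simp: r_coset_def)
    then have "Poly_Mapping.keys d \<subseteq> carrier L \<times> carrier N"
      using A.kernel_keys[of k] assms keys_add[of k c] by blast
    then show ?thesis
      using keys assms k frag_map_kernel[of k] by (subst B.coset_eq_iff) (blast, blast, simp add: B.teq_def)
  qed
  moreover have "c \<in> A.kernel #>\<^bsub>A.free\<^esub> c"
    using A.kernel_zero by (force simp: r_coset_def)
  ultimately show ?thesis
    unfolding tensor_map_def frag_map_def[symmetric] by blast
qed

end

section \<open>Vanishing of tensors\<close>

context module
begin

lemma finsum_smult_swap:
  assumes "finite T" "a \<in> T \<rightarrow> carrier R"
    and "\<And>t u. \<lbrakk>t \<in> T; u \<in> U\<rbrakk> \<Longrightarrow> b t u \<in> carrier R" and "w \<in> U \<rightarrow> carrier M"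
  shows "(\<Oplus>\<^bsub>M\<^esub>u\<in>U. (\<Oplus>t\<in>T. a t \<otimes> b t u) \<odot>\<^bsub>M\<^esub> w u)
    = (\<Oplus>\<^bsub>M\<^esub>t\<in>T. a t \<odot>\<^bsub>M\<^esub> (\<Oplus>\<^bsub>M\<^esub>u\<in>U. b t u \<odot>\<^bsub>M\<^esub> w u))"
  using assms(1-3)
proof (induction T rule: finite_induct)
  case empty
  then show ?case using assms(4) by (simp add: Pi_iff cong: M.finsum_cong)
next
  case (insert i T)
  have w: "w u \<in> carrier M" if "u \<in> U" for u using assms(4) that by auto
  have b: "b i u \<in> carrier R" if "u \<in> U" for u using insert.prems that by simp
  have ai: "a i \<in> carrier R" using insert.prems by simp
  have ab: "(\<lambda>t. a t \<otimes> b t u) \<in> T \<rightarrow> carrier R" if "u \<in> U" for u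
    using insert.prems that by (auto simp: Pi_iff)
  have inner: "(\<Oplus>\<^bsub>M\<^esub>u\<in>U. b t u \<odot>\<^bsub>M\<^esub> w u) \<in> carrier M" if "t \<in> insert i T" for t
    using insert.prems that w by (intro M.finsum_closed) auto
  have "(\<Oplus>\<^bsub>M\<^esub>u\<in>U. (\<Oplus>t\<in>insert i T. a t \<otimes> b t u) \<odot>\<^bsub>M\<^esub> w u)
    = (\<Oplus>\<^bsub>M\<^esub>u\<in>U. a i \<odot>\<^bsub>M\<^esub> (b i u \<odot>\<^bsub>M\<^esub> w u) \<oplus>\<^bsub>M\<^esub> (\<Oplus>t\<in>T. a t \<otimes> b t u) \<odot>\<^bsub>M\<^esub> w u)"
  proof (rule M.finsum_cong')
    fix u assume u: "u \<in> U"
    have "(\<Oplus>t\<in>insert i T. a t \<otimes> b t u) = a i \<otimes> b i u \<oplus> (\<Oplus>t\<in>T. a t \<otimes> b t u)"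
      using insert.hyps ab[OF u] ai b[OF u] by (intro R.finsum_insert) auto
    then show "(\<Oplus>t\<in>insert i T. a t \<otimes> b t u) \<odot>\<^bsub>M\<^esub> w u
      = a i \<odot>\<^bsub>M\<^esub> (b i u \<odot>\<^bsub>M\<^esub> w u) \<oplus>\<^bsub>M\<^esub> (\<Oplus>t\<in>T. a t \<otimes> b t u) \<odot>\<^bsub>M\<^esub> w u"
      using ai b[OF u] w[OF u] ab[OF u] by (simp add: smult_l_distr smult_assoc1)
  qed (use ai b w ab in \<open>auto simp: Pi_iff\<close>)
  also have "\<dots> = (\<Oplus>\<^bsub>M\<^esub>u\<in>U. a i \<odot>\<^bsub>M\<^esub> (b i u \<odot>\<^bsub>M\<^esub> w u))
      \<oplus>\<^bsub>M\<^esub> (\<Oplus>\<^bsub>M\<^esub>u\<in>U. (\<Oplus>t\<in>T. a t \<otimes> b t u) \<odot>\<^bsub>M\<^esub> w u)"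
    using ai b w ab by (intro M.finsum_addf) (auto simp: Pi_iff)
  also have "(\<Oplus>\<^bsub>M\<^esub>u\<in>U. a i \<odot>\<^bsub>M\<^esub> (b i u \<odot>\<^bsub>M\<^esub> w u)) = a i \<odot>\<^bsub>M\<^esub> (\<Oplus>\<^bsub>M\<^esub>u\<in>U. b i u \<odot>\<^bsub>M\<^esub> w u)"
  \<comment> \<open>Only \<open>T\<close> is assumed finite. A sum over an infinite \<open>U\<close>
    is zero by convention, so both sides vanish.\<close>
  proof (cases "finite U")
    case True
    then show ?thesis using ai b w by (intro finsum_smult_ldistr[symmetric]) auto
  qed (simp add: ai)
  also have "(\<Oplus>\<^bsub>M\<^esub>u\<in>U. (\<Oplus>t\<in>T. a t \<otimes> b t u) \<odot>\<^bsub>M\<^esub> w u)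
      = (\<Oplus>\<^bsub>M\<^esub>t\<in>T. a t \<odot>\<^bsub>M\<^esub> (\<Oplus>\<^bsub>M\<^esub>u\<in>U. b t u \<odot>\<^bsub>M\<^esub> w u))"
    using insert.prems by (intro insert.IH) auto
  also have "a i \<odot>\<^bsub>M\<^esub> (\<Oplus>\<^bsub>M\<^esub>u\<in>U. b i u \<odot>\<^bsub>M\<^esub> w u) \<oplus>\<^bsub>M\<^esub> \<dots>
      = (\<Oplus>\<^bsub>M\<^esub>t\<in>insert i T. a t \<odot>\<^bsub>M\<^esub> (\<Oplus>\<^bsub>M\<^esub>u\<in>U. b t u \<odot>\<^bsub>M\<^esub> w u))"
    using insert.hyps insert.prems inner by (intro M.finsum_insert[symmetric]) auto
  finally show ?case .
qed

lemma finsum_delta: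
  assumes "finite T" "i \<in> T" "x \<in> T \<rightarrow> carrier M" "r \<in> carrier R"
  shows "(\<Oplus>\<^bsub>M\<^esub>t\<in>T. (if t = i then r else \<zero>) \<odot>\<^bsub>M\<^esub> x t) = r \<odot>\<^bsub>M\<^esub> x i"
proof -
  have "(\<Oplus>\<^bsub>M\<^esub>t\<in>T. (if t = i then r else \<zero>) \<odot>\<^bsub>M\<^esub> x t)
    = (\<Oplus>\<^bsub>M\<^esub>t\<in>T. if t = i then r \<odot>\<^bsub>M\<^esub> x t else \<zero>\<^bsub>M\<^esub>)"
    using assms by (intro M.finsum_cong') (auto simp: Pi_iff)
  also have "\<dots> = r \<odot>\<^bsub>M\<^esub> x i"
    using assms by (intro M.add.finprod_singleton_swap) (auto simp: Pi_iff)
  finally show ?thesis .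
qed

lemma finsum_smult_closed: "\<lbrakk>c \<in> T \<rightarrow> carrier R; x \<in> T \<rightarrow> carrier M\<rbrakk>
    \<Longrightarrow> (\<Oplus>\<^bsub>M\<^esub>t\<in>T. c t \<odot>\<^bsub>M\<^esub> x t) \<in> carrier M"
  by (intro M.finsum_closed) auto

lemma finsum_add_smult:
  assumes "c \<in> T \<rightarrow> carrier R" "d \<in> T \<rightarrow> carrier R" "x \<in> T \<rightarrow> carrier M"
  shows "(\<Oplus>\<^bsub>M\<^esub>t\<in>T. (c t \<oplus> d t) \<odot>\<^bsub>M\<^esub> x t)
    = (\<Oplus>\<^bsub>M\<^esub>t\<in>T. c t \<odot>\<^bsub>M\<^esub> x t) \<oplus>\<^bsub>M\<^esub> (\<Oplus>\<^bsub>M\<^esub>t\<in>T. d t \<odot>\<^bsub>M\<^esub> x t)"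
proof -
  have "(\<Oplus>\<^bsub>M\<^esub>t\<in>T. (c t \<oplus> d t) \<odot>\<^bsub>M\<^esub> x t)
    = (\<Oplus>\<^bsub>M\<^esub>t\<in>T. c t \<odot>\<^bsub>M\<^esub> x t \<oplus>\<^bsub>M\<^esub> d t \<odot>\<^bsub>M\<^esub> x t)"
    using assms by (intro M.finsum_cong') (auto simp: smult_l_distr Pi_iff)
  also have "\<dots> = (\<Oplus>\<^bsub>M\<^esub>t\<in>T. c t \<odot>\<^bsub>M\<^esub> x t) \<oplus>\<^bsub>M\<^esub> (\<Oplus>\<^bsub>M\<^esub>t\<in>T. d t \<odot>\<^bsub>M\<^esub> x t)"
    using assms by (intro M.finsum_addf) auto
  finally show ?thesis .
qed

lemma finsum_mult_smult:
  assumes "finite T" "r \<in> carrier R" "c \<in> T \<rightarrow> carrier R" "x \<in> T \<rightarrow> carrier M"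
  shows "(\<Oplus>\<^bsub>M\<^esub>t\<in>T. (r \<otimes> c t) \<odot>\<^bsub>M\<^esub> x t) = r \<odot>\<^bsub>M\<^esub> (\<Oplus>\<^bsub>M\<^esub>t\<in>T. c t \<odot>\<^bsub>M\<^esub> x t)"
proof -
  have "(\<Oplus>\<^bsub>M\<^esub>t\<in>T. (r \<otimes> c t) \<odot>\<^bsub>M\<^esub> x t) = (\<Oplus>\<^bsub>M\<^esub>t\<in>T. r \<odot>\<^bsub>M\<^esub> (c t \<odot>\<^bsub>M\<^esub> x t))"
    using assms by (intro M.finsum_cong') (auto simp: smult_assoc1 Pi_iff)
  also have "\<dots> = r \<odot>\<^bsub>M\<^esub> (\<Oplus>\<^bsub>M\<^esub>t\<in>T. c t \<odot>\<^bsub>M\<^esub> x t)"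
    using assms by (intro finsum_smult_ldistr[symmetric]) auto
  finally show ?thesis .
qed

lemma finsum_uminus_smult:
  assumes "finite T" "c \<in> T \<rightarrow> carrier R" "x \<in> T \<rightarrow> carrier M"
  shows "(\<Oplus>\<^bsub>M\<^esub>t\<in>T. (\<ominus> c t) \<odot>\<^bsub>M\<^esub> x t) = \<ominus>\<^bsub>M\<^esub> (\<Oplus>\<^bsub>M\<^esub>t\<in>T. c t \<odot>\<^bsub>M\<^esub> x t)"
proof -
  have "(\<Oplus>\<^bsub>M\<^esub>t\<in>T. (\<ominus> c t) \<odot>\<^bsub>M\<^esub> x t) = (\<Oplus>\<^bsub>M\<^esub>t\<in>T. (\<ominus> \<one> \<otimes> c t) \<odot>\<^bsub>M\<^esub> x t)"
    using assms by (intro M.finsum_cong') (auto simp: R.l_minus Pi_iff)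
  also have "\<dots> = \<ominus> \<one> \<odot>\<^bsub>M\<^esub> (\<Oplus>\<^bsub>M\<^esub>t\<in>T. c t \<odot>\<^bsub>M\<^esub> x t)"
    using assms by (intro finsum_mult_smult) auto
  finally show ?thesis
    using finsum_smult_closed[OF assms(2,3)] by (simp add: smult_l_minus)
qed

text \<open>Applied to a copy of \<open>R\<close>, this makes the ideal generated by finitely many
  coefficients a module of its own, which can serve as a test module for flatness.\<close>

lemma combinations_submodule:
  assumes "finite T" "x \<in> T \<rightarrow> carrier M"
  shows "submodule {\<Oplus>\<^bsub>M\<^esub>t\<in>T. c t \<odot>\<^bsub>M\<^esub> x t | c. c \<in> T \<rightarrow> carrier R} R M" (is "submodule ?H R M")
proof (rule submoduleI)
  show sub: "?H \<subseteq> carrier M"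
    using assms finsum_smult_closed by auto
  have "(\<Oplus>\<^bsub>M\<^esub>t\<in>T. \<zero> \<odot>\<^bsub>M\<^esub> x t) = (\<Oplus>\<^bsub>M\<^esub>t\<in>T. \<zero>\<^bsub>M\<^esub>)"
    using assms by (intro M.finsum_cong') (auto simp: Pi_iff)
  then show "\<zero>\<^bsub>M\<^esub> \<in> ?H"
    by (auto intro!: exI[of _ "\<lambda>_. \<zero>"])
  show smult: "r \<odot>\<^bsub>M\<^esub> y \<in> ?H" if r: "r \<in> carrier R" and y: "y \<in> ?H" for r y
  proof -
    obtain c where c: "c \<in> T \<rightarrow> carrier R" "y = (\<Oplus>\<^bsub>M\<^esub>t\<in>T. c t \<odot>\<^bsub>M\<^esub> x t)"
      using y by auto
    have "r \<odot>\<^bsub>M\<^esub> y = (\<Oplus>\<^bsub>M\<^esub>t\<in>T. (r \<otimes> c t) \<odot>\<^bsub>M\<^esub> x t)"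
      unfolding c(2) using finsum_mult_smult[OF assms(1) r c(1) assms(2)] by simp
    moreover have "(\<lambda>t. r \<otimes> c t) \<in> T \<rightarrow> carrier R" using c r by auto
    ultimately show ?thesis by (intro CollectI exI[of _ "\<lambda>t. r \<otimes> c t"] conjI)
  qed
  show "\<ominus>\<^bsub>M\<^esub> y \<in> ?H" if "y \<in> ?H" for y
    using smult[of "\<ominus> \<one>" y] that sub by (simp add: smult_l_minus subset_iff)
  show "y \<oplus>\<^bsub>M\<^esub> z \<in> ?H" if y: "y \<in> ?H" and z: "z \<in> ?H" for y z
  proof -
    obtain c d where c: "c \<in> T \<rightarrow> carrier R" "y = (\<Oplus>\<^bsub>M\<^esub>t\<in>T. c t \<odot>\<^bsub>M\<^esub> x t)"
      and d: "d \<in> T \<rightarrow> carrier R" "z = (\<Oplus>\<^bsub>M\<^esub>t\<in>T. d t \<odot>\<^bsub>M\<^esub> x t)"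
      using y z by auto
    have "y \<oplus>\<^bsub>M\<^esub> z = (\<Oplus>\<^bsub>M\<^esub>t\<in>T. (c t \<oplus> d t) \<odot>\<^bsub>M\<^esub> x t)"
      unfolding c(2) d(2) using finsum_add_smult[OF c(1) d(1) assms(2)] by simp
    moreover have "(\<lambda>t. c t \<oplus> d t) \<in> T \<rightarrow> carrier R" using c(1) d(1) by (simp add: Pi_iff)
    ultimately show ?thesis by (intro CollectI exI[of _ "\<lambda>t. c t \<oplus> d t"] conjI)
  qed
qed

text \<open>\<open>finsum\<close> folds inside the carrier of its record, so shrinking the carrier
  is not harmless by definition. The lemma carries linear relations between a submodule and the
  ambient module.\<close>

lemma finsum_submodule:
  assumes "submodule H R M" "f \<in> T \<rightarrow> H"
  shows "finsum (M\<lparr>carrier := H\<rparr>) f T = finsum M f T"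
proof -
  interpret H: module R "M\<lparr>carrier := H\<rparr>"
    by (rule submodule.submodule_is_module[OF assms(1) module_axioms])
  have sub: "H \<subseteq> carrier M" by (rule submoduleE(1)[OF assms(1)])
  show ?thesis
    using assms(2)
  proof (induction T rule: infinite_finite_induct)
    case (insert t T)
    then have f: "f \<in> T \<rightarrow> H" "f t \<in> H" by auto
    then have "f \<in> T \<rightarrow> carrier M" "f t \<in> carrier M" using sub by auto
    then show ?case using insert f by simp
  qed auto
qed

end

text \<open>The families \<open>m\<close> of the form \<open>m j = \<Sum>t. a j t y t\<close> with \<open>\<Sum>j. a j t x j = 0\<close> for all \<open>t\<close>. For
  them \<open>\<Sum>j. x j \<otimes> m j\<close> vanishes; conversely this is the only way in which it can vanish if the \<open>x j\<close>
  generate \<open>L\<close>, or if \<open>N\<close> is flat.\<close>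

inductive trivial_family ::
    "('r, 'a) ring_scheme \<Rightarrow> ('r, 'l, 'c) module_scheme \<Rightarrow> ('r, 'n, 'd) module_scheme
      \<Rightarrow> 'i set \<Rightarrow> ('i \<Rightarrow> 'l) \<Rightarrow> ('i \<Rightarrow> 'n) \<Rightarrow> bool"
  for R L N J x where
  zero: "(\<And>j. j \<in> J \<Longrightarrow> m j = \<zero>\<^bsub>N\<^esub>) \<Longrightarrow> trivial_family R L N J x m"
| add_relation: "\<lbrakk>trivial_family R L N J x m; k \<in> J \<rightarrow> carrier R;
    (\<Oplus>\<^bsub>L\<^esub>j\<in>J. k j \<odot>\<^bsub>L\<^esub> x j) = \<zero>\<^bsub>L\<^esub>; y \<in> carrier N;
    \<And>j. j \<in> J \<Longrightarrow> m' j = m j \<oplus>\<^bsub>N\<^esub> k j \<odot>\<^bsub>N\<^esub> y\<rbrakk> \<Longrightarrow> trivial_family R L N J x m'"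

context tensor_pair
begin

lemma trivial_family_closed: "\<lbrakk>trivial_family R L N J x m; j \<in> J\<rbrakk> \<Longrightarrow> m j \<in> carrier N"
  by (induction rule: trivial_family.induct) auto

lemma trivial_family_cong:
  assumes "trivial_family R L N J x m" "\<And>j. j \<in> J \<Longrightarrow> m' j = m j"
  shows "trivial_family R L N J x m'"
  using assms(1)
proof cases
  case zero
  then show ?thesis using assms(2) by (auto intro: trivial_family.zero)
next
  case (add_relation m k y)
  then show ?thesis using assms(2) by (auto intro: trivial_family.add_relation)
qed

text \<open>The inductive form is convenient for closure properties, the matrix form for the
  equational criterion. Each use of \<open>add_relation\<close> contributes one column.\<close>

lemma trivial_familyE:
  assumes "trivial_family R L N J x m"
  obtains n :: nat and a y where "y \<in> {..<n} \<rightarrow> carrier N"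
    and "\<And>j t. \<lbrakk>j \<in> J; t < n\<rbrakk> \<Longrightarrow> a j t \<in> carrier R"
    and "\<And>j. j \<in> J \<Longrightarrow> m j = (\<Oplus>\<^bsub>N\<^esub>t\<in>{..<n}. a j t \<odot>\<^bsub>N\<^esub> y t)"
    and "\<And>t. t < n \<Longrightarrow> (\<Oplus>\<^bsub>L\<^esub>j\<in>J. a j t \<odot>\<^bsub>L\<^esub> x j) = \<zero>\<^bsub>L\<^esub>"
proof -
  have "\<exists>(n::nat) a y. y \<in> {..<n} \<rightarrow> carrier N \<and> (\<forall>j\<in>J. \<forall>t<n. a j t \<in> carrier R) \<and>
      (\<forall>j\<in>J. m j = (\<Oplus>\<^bsub>N\<^esub>t\<in>{..<n}. a j t \<odot>\<^bsub>N\<^esub> y t)) \<and>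
      (\<forall>t<n. (\<Oplus>\<^bsub>L\<^esub>j\<in>J. a j t \<odot>\<^bsub>L\<^esub> x j) = \<zero>\<^bsub>L\<^esub>)"
    using assms
  proof (induction rule: trivial_family.induct)
    case (zero m)
    then show ?case by (intro exI[of _ 0]) auto
  next
    case (add_relation m k y m')
    then obtain n :: nat and a z where z: "z \<in> {..<n} \<rightarrow> carrier N"
      and a: "\<And>j t. \<lbrakk>j \<in> J; t < n\<rbrakk> \<Longrightarrow> a j t \<in> carrier R"
      and m: "\<And>j. j \<in> J \<Longrightarrow> m j = (\<Oplus>\<^bsub>N\<^esub>t\<in>{..<n}. a j t \<odot>\<^bsub>N\<^esub> z t)"
      and rel: "\<And>t. t < n \<Longrightarrow> (\<Oplus>\<^bsub>L\<^esub>j\<in>J. a j t \<odot>\<^bsub>L\<^esub> x j) = \<zero>\<^bsub>L\<^esub>"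
      by blast
    let ?a = "\<lambda>j t. if t = n then k j else a j t"
    let ?z = "\<lambda>t. if t = n then y else z t"
    have c1: "m' j = (\<Oplus>\<^bsub>N\<^esub>t\<in>{..<Suc n}. ?a j t \<odot>\<^bsub>N\<^esub> ?z t)" if j: "j \<in> J" for j
    proof -
      have kj: "k j \<in> carrier R" using add_relation.hyps j by auto
      have cl: "(\<lambda>t. a j t \<odot>\<^bsub>N\<^esub> z t) \<in> {..<n} \<rightarrow> carrier N" using a[OF j] z by auto
      have "(\<Oplus>\<^bsub>N\<^esub>t\<in>{..<Suc n}. ?a j t \<odot>\<^bsub>N\<^esub> ?z t) = k j \<odot>\<^bsub>N\<^esub> y \<oplus>\<^bsub>N\<^esub> (\<Oplus>\<^bsub>N\<^esub>t\<in>{..<n}. ?a j t \<odot>\<^bsub>N\<^esub> ?z t)"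
        unfolding lessThan_Suc using a[OF j] z kj add_relation.hyps
        by (subst N.M.finsum_insert) (auto simp: Pi_iff)
      also have "(\<Oplus>\<^bsub>N\<^esub>t\<in>{..<n}. ?a j t \<odot>\<^bsub>N\<^esub> ?z t) = m j"
        unfolding m[OF j] using cl by (intro N.M.finsum_cong') auto
      finally show ?thesis
        using add_relation.hyps j kj trivial_family_closed[OF add_relation.hyps(1) j]
        by (simp add: N.M.a_comm)
    qed
    have c2: "(\<Oplus>\<^bsub>L\<^esub>j\<in>J. ?a j t \<odot>\<^bsub>L\<^esub> x j) = \<zero>\<^bsub>L\<^esub>" if "t < Suc n" for t
      using that rel[of t] add_relation.hyps by (cases "t = n") auto
    have c3: "?a j t \<in> carrier R" if "j \<in> J" "t < Suc n" for j t
      using that a[of j t] add_relation.hyps by auto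
    have c4: "?z \<in> {..<Suc n} \<rightarrow> carrier N"
      using z add_relation.hyps by (auto simp: Pi_iff)
    show ?case
      by (intro exI[of _ "Suc n"] exI[of _ ?a] exI[of _ ?z] conjI ballI allI impI c1 c2 c3 c4)
  qed
  then show thesis using that by blast
qed

lemma trivial_familyI:
  assumes "finite T" "y \<in> T \<rightarrow> carrier N"
    and "\<And>j t. \<lbrakk>j \<in> J; t \<in> T\<rbrakk> \<Longrightarrow> a j t \<in> carrier R"
    and "\<And>j. j \<in> J \<Longrightarrow> m j = (\<Oplus>\<^bsub>N\<^esub>t\<in>T. a j t \<odot>\<^bsub>N\<^esub> y t)"
    and "\<And>t. t \<in> T \<Longrightarrow> (\<Oplus>\<^bsub>L\<^esub>j\<in>J. a j t \<odot>\<^bsub>L\<^esub> x j) = \<zero>\<^bsub>L\<^esub>"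
  shows "trivial_family R L N J x m"
  using assms
proof (induction T arbitrary: m rule: finite_induct)
  case empty
  then show ?case by (intro trivial_family.zero) auto
next
  case (insert i T)
  have cl: "(\<lambda>t. a j t \<odot>\<^bsub>N\<^esub> y t) \<in> insert i T \<rightarrow> carrier N" if "j \<in> J" for j
    using insert.prems(1,2) that by (auto simp: Pi_iff)
  have "trivial_family R L N J x (\<lambda>j. \<Oplus>\<^bsub>N\<^esub>t\<in>T. a j t \<odot>\<^bsub>N\<^esub> y t)"
    using insert.prems by (intro insert.IH) auto
  then show ?case
  proof (rule trivial_family.add_relation[of _ _ _ _ _ _ "\<lambda>j. a j i" "y i"])
    show "m j = (\<Oplus>\<^bsub>N\<^esub>t\<in>T. a j t \<odot>\<^bsub>N\<^esub> y t) \<oplus>\<^bsub>N\<^esub> a j i \<odot>\<^bsub>N\<^esub> y i" if "j \<in> J" for j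
    proof -
      have "(\<Oplus>\<^bsub>N\<^esub>t\<in>insert i T. a j t \<odot>\<^bsub>N\<^esub> y t) = a j i \<odot>\<^bsub>N\<^esub> y i \<oplus>\<^bsub>N\<^esub> (\<Oplus>\<^bsub>N\<^esub>t\<in>T. a j t \<odot>\<^bsub>N\<^esub> y t)"
        using insert.hyps cl[OF that] by (intro N.M.finsum_insert) (auto simp: Pi_iff)
      moreover have "(\<Oplus>\<^bsub>N\<^esub>t\<in>T. a j t \<odot>\<^bsub>N\<^esub> y t) \<in> carrier N" "a j i \<odot>\<^bsub>N\<^esub> y i \<in> carrier N"
        using cl[OF that] by auto
      ultimately show ?thesis using insert.prems(3)[OF that] by (simp add: N.M.a_comm)
    qed
  qed (use insert.prems in auto)
qed

lemma trivial_family_relation: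
  assumes "k \<in> J \<rightarrow> carrier R" "(\<Oplus>\<^bsub>L\<^esub>j\<in>J. k j \<odot>\<^bsub>L\<^esub> x j) = \<zero>\<^bsub>L\<^esub>" "y \<in> carrier N"
  shows "trivial_family R L N J x (\<lambda>j. k j \<odot>\<^bsub>N\<^esub> y)"
proof -
  have "trivial_family R L N J x (\<lambda>j. \<zero>\<^bsub>N\<^esub>)" by (rule trivial_family.zero) simp
  then show ?thesis
    by (rule trivial_family.add_relation[of _ _ _ _ _ _ k y]) (use assms in \<open>auto simp: Pi_iff\<close>)
qed

lemma trivial_family_add:
  assumes "trivial_family R L N J x m" "trivial_family R L N J x m'"
  shows "trivial_family R L N J x (\<lambda>j. m j \<oplus>\<^bsub>N\<^esub> m' j)"
  using assms(2)
proof (induction rule: trivial_family.induct)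
  case (zero m')
  then show ?case
    using trivial_family_cong[OF assms(1), of "\<lambda>j. m j \<oplus>\<^bsub>N\<^esub> m' j"] trivial_family_closed[OF assms(1)]
    by simp
next
  case (add_relation m1 k y m2)
  show ?case
  proof (rule trivial_family.add_relation[OF add_relation.IH add_relation.hyps(2-4)])
    fix j assume j: "j \<in> J"
    have "k j \<odot>\<^bsub>N\<^esub> y \<in> carrier N" using add_relation.hyps j by auto
    then show "m j \<oplus>\<^bsub>N\<^esub> m2 j = m j \<oplus>\<^bsub>N\<^esub> m1 j \<oplus>\<^bsub>N\<^esub> k j \<odot>\<^bsub>N\<^esub> y"
      using add_relation.hyps(5)[OF j] trivial_family_closed[OF assms(1) j]
        trivial_family_closed[OF add_relation.hyps(1) j] by (simp add: N.M.a_assoc)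
  qed
qed

text \<open>The sign goes to the module element \<open>y\<close>, so the coefficients
  \<open>k\<close> of the relation stay as they are.\<close>

lemma trivial_family_uminus:
  assumes "trivial_family R L N J x m"
  shows "trivial_family R L N J x (\<lambda>j. \<ominus>\<^bsub>N\<^esub> m j)"
  using assms
proof (induction rule: trivial_family.induct)
  case (zero m)
  then show ?case by (intro trivial_family.zero) simp
next
  case (add_relation m k y m')
  show ?case
  proof (rule trivial_family.add_relation[OF add_relation.IH add_relation.hyps(2,3)])
    show "\<ominus>\<^bsub>N\<^esub> y \<in> carrier N" using add_relation.hyps by simp
    fix j assume j: "j \<in> J"
    then show "\<ominus>\<^bsub>N\<^esub> m' j = \<ominus>\<^bsub>N\<^esub> m j \<oplus>\<^bsub>N\<^esub> k j \<odot>\<^bsub>N\<^esub> (\<ominus>\<^bsub>N\<^esub> y)"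
      using add_relation.hyps j trivial_family_closed[OF add_relation.hyps(1) j]
      by (simp add: N.M.minus_add N.smult_r_minus Pi_iff)
  qed
qed

lemma trivial_family_sum:
  assumes "finite T" "\<And>t. t \<in> T \<Longrightarrow> trivial_family R L N J x (m t)"
  shows "trivial_family R L N J x (\<lambda>j. \<Oplus>\<^bsub>N\<^esub>t\<in>T. m t j)"
  using assms
proof (induction T rule: finite_induct)
  case empty
  then show ?case by (intro trivial_family.zero) simp
next
  case (insert i T)
  have cl: "m t j \<in> carrier N" if "j \<in> J" "t \<in> insert i T" for j t
    using trivial_family_closed[OF insert.prems[OF that(2)] that(1)] .
  have "trivial_family R L N J x (\<lambda>j. m i j \<oplus>\<^bsub>N\<^esub> (\<Oplus>\<^bsub>N\<^esub>t\<in>T. m t j))"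
    using insert by (intro trivial_family_add) auto
  then show ?case
    by (rule trivial_family_cong) (use insert.hyps cl in \<open>simp add: Pi_iff\<close>)
qed

text \<open>Choosing coefficients of every \<open>u\<close> with respect to the generators \<open>x j\<close> defines homomorphisms
  \<open>h j\<close> from the free group to \<open>N\<close>. The family of their values is trivial on the relations, and on
  \<open>\<Sum>j. x j \<otimes> m j\<close> it differs from \<open>m\<close> by a trivial family.\<close>

lemma trivial_family_if_kernel:
  fixes J :: "'i set"
  assumes fin: "finite J" and x: "x \<in> J \<rightarrow> carrier L" and m: "m \<in> J \<rightarrow> carrier N"
    and gen: "\<And>u. u \<in> carrier L \<Longrightarrow> \<exists>c\<in>J \<rightarrow> carrier R. u = (\<Oplus>\<^bsub>L\<^esub>j\<in>J. c j \<odot>\<^bsub>L\<^esub> x j)"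
    and kernel: "(\<Sum>j\<in>J. frag_of (x j, m j)) \<in> kernel"
  shows "trivial_family R L N J x m"
proof -
  \<comment> \<open>The choice of coefficients need not be additive or linear in \<open>u\<close>,
    so the resulting maps need not vanish on the relations. Their values there are nevertheless
    controlled, because every defect of linearity is a relation among the
    \<open>x j\<close>.\<close>
  have "\<forall>u\<in>carrier L. \<exists>c. c \<in> J \<rightarrow> carrier R \<and> (\<Oplus>\<^bsub>L\<^esub>j\<in>J. c j \<odot>\<^bsub>L\<^esub> x j) = u"
  proof
    fix u assume "u \<in> carrier L"
    from gen[OF this] obtain c where "c \<in> J \<rightarrow> carrier R" "u = (\<Oplus>\<^bsub>L\<^esub>j\<in>J. c j \<odot>\<^bsub>L\<^esub> x j)" ..
    then show "\<exists>c. c \<in> J \<rightarrow> carrier R \<and> (\<Oplus>\<^bsub>L\<^esub>j\<in>J. c j \<odot>\<^bsub>L\<^esub> x j) = u"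
      by (intro exI[of _ c] conjI) simp_all
  qed
  then obtain co where "\<forall>u\<in>carrier L. co u \<in> J \<rightarrow> carrier R \<and> (\<Oplus>\<^bsub>L\<^esub>j\<in>J. co u j \<odot>\<^bsub>L\<^esub> x j) = u"
    unfolding bchoice_iff by blast
  then have coPi: "\<And>u. u \<in> carrier L \<Longrightarrow> co u \<in> J \<rightarrow> carrier R"
    and co_sum: "\<And>u. u \<in> carrier L \<Longrightarrow> (\<Oplus>\<^bsub>L\<^esub>j\<in>J. co u j \<odot>\<^bsub>L\<^esub> x j) = u"
    by blast+
  have co: "co u j \<in> carrier R" if "u \<in> carrier L" "j \<in> J" for u j
    using coPi[OF that(1)] that(2) by (rule funcset_mem)
  have "\<exists>h. h \<in> hom free (add_monoid N) \<and>
      (\<forall>u\<in>carrier L. \<forall>v\<in>carrier N. h (frag_of (u, v)) = co u j \<odot>\<^bsub>N\<^esub> v)" if "j \<in> J" for j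
  proof -
    have "(\<lambda>(u, v). co u j \<odot>\<^bsub>N\<^esub> v) ` (carrier L \<times> carrier N) \<subseteq> carrier (add_monoid N)"
      using co that by auto
    then obtain h where "h \<in> hom free (add_monoid N)"
      "\<And>p. p \<in> carrier L \<times> carrier N \<Longrightarrow> h (frag_of p) = (\<lambda>(u, v). co u j \<odot>\<^bsub>N\<^esub> v) p"
      using comm_group.free_Abelian_group_universal[OF N.M.a_comm_group] by metis
    then show ?thesis by (intro exI[of _ h]) auto
  qed
  then obtain h where h: "\<And>j. j \<in> J \<Longrightarrow> h j \<in> hom free (add_monoid N)"
    and h_of: "\<And>j u v. \<lbrakk>j \<in> J; u \<in> carrier L; v \<in> carrier N\<rbrakk> \<Longrightarrow> h j (frag_of (u, v)) = co u j \<odot>\<^bsub>N\<^esub> v"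
    by metis
  let ?S = "carrier L \<times> carrier N"
  have h_group: "group_hom free (add_monoid N) (h j)" if "j \<in> J" for j
    using h[OF that] N.M.a_comm_group
    by (simp add: group_hom_def group_hom_axioms_def comm_group_def)
  have h_closed: "h j c \<in> carrier N" if "j \<in> J" "Poly_Mapping.keys c \<subseteq> ?S" for j c
    using group_hom.hom_closed[OF h_group[OF that(1)], of c] that(2) by simp
  have h_0: "h j 0 = \<zero>\<^bsub>N\<^esub>" if "j \<in> J" for j
    using group_hom.hom_one[OF h_group[OF that]] by simp
  have h_add: "h j (c + d) = h j c \<oplus>\<^bsub>N\<^esub> h j d"
    if "j \<in> J" "Poly_Mapping.keys c \<subseteq> ?S" "Poly_Mapping.keys d \<subseteq> ?S" for j c d
    using group_hom.hom_mult[OF h_group[OF that(1)], of c d] that(2,3) by simp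
  have h_uminus: "h j (- c) = \<ominus>\<^bsub>N\<^esub> h j c" if "j \<in> J" "Poly_Mapping.keys c \<subseteq> ?S" for j c
    using group_hom.hom_inv[OF h_group[OF that(1)], of c] that(2) by (simp add: a_inv_def)
  have h_diff: "h j (c - d) = h j c \<oplus>\<^bsub>N\<^esub> \<ominus>\<^bsub>N\<^esub> h j d"
    if "j \<in> J" "Poly_Mapping.keys c \<subseteq> ?S" "Poly_Mapping.keys d \<subseteq> ?S" for j c d
    using h_add[of j c "- d"] h_uminus[of j d] that by simp
  have h_kernel: "trivial_family R L N J x (\<lambda>j. h j c)" if "c \<in> kernel" for c
    using that
  proof (induction rule: kernel_induct)
    case zero
    then show ?case using h_0 by (intro trivial_family.zero)
  next
    case (relation c)
    then show ?case
    proof (cases rule: tensor_relationsE)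
      case (add_left u u' v)
      \<comment> \<open>The defect of additivity of \<open>co\<close>. Its combination of the
        \<open>x j\<close> is \<open>(u + u') - u - u' = 0\<close>, so it is an admissible relation;
        the defect for scalars below is treated in the same way.\<close>
      let ?k = "\<lambda>j. co (u \<oplus>\<^bsub>L\<^esub> u') j \<oplus>\<^bsub>R\<^esub> (\<ominus>\<^bsub>R\<^esub> co u j \<oplus>\<^bsub>R\<^esub> \<ominus>\<^bsub>R\<^esub> co u' j)"
      have cl: "co (u \<oplus>\<^bsub>L\<^esub> u') \<in> J \<rightarrow> carrier R" "co u \<in> J \<rightarrow> carrier R" "co u' \<in> J \<rightarrow> carrier R"
        using add_left coPi by auto
      then have cl': "(\<lambda>j. \<ominus>\<^bsub>R\<^esub> co u j) \<in> J \<rightarrow> carrier R" "(\<lambda>j. \<ominus>\<^bsub>R\<^esub> co u' j) \<in> J \<rightarrow> carrier R"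
        "(\<lambda>j. \<ominus>\<^bsub>R\<^esub> co u j \<oplus>\<^bsub>R\<^esub> \<ominus>\<^bsub>R\<^esub> co u' j) \<in> J \<rightarrow> carrier R"
        by (simp_all add: Pi_iff)
      have "(\<Oplus>\<^bsub>L\<^esub>j\<in>J. ?k j \<odot>\<^bsub>L\<^esub> x j) = \<zero>\<^bsub>L\<^esub>"
        using add_left cl x fin
        by (simp add: L.finsum_add_smult cl' L.finsum_uminus_smult co_sum L.M.minus_add[symmetric] L.M.r_neg)
      then have "trivial_family R L N J x (\<lambda>j. ?k j \<odot>\<^bsub>N\<^esub> v)"
        using add_left cl by (intro trivial_family_relation) (simp_all add: Pi_iff)
      then show ?thesis
      proof (rule trivial_family_cong)
        fix j assume j: "j \<in> J"
        have "co (u \<oplus>\<^bsub>L\<^esub> u') j \<in> carrier R" "co u j \<in> carrier R" "co u' j \<in> carrier R"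
          using j cl by auto
        then show "h j c = ?k j \<odot>\<^bsub>N\<^esub> v"
          using add_left j
          by (simp add: h_diff h_of keys_minus_subset N.smult_l_distr N.smult_l_minus N.M.a_assoc)
      qed
    next
      case (add_right u v v')
      \<comment> \<open>No defect occurs here: the coefficients depend only on the first component
        \<open>u\<close>.\<close>
      have "h j c = \<zero>\<^bsub>N\<^esub>" if j: "j \<in> J" for j
      proof -
        let ?a = "co u j \<odot>\<^bsub>N\<^esub> v" and ?b = "co u j \<odot>\<^bsub>N\<^esub> v'"
        have cl: "?a \<in> carrier N" "?b \<in> carrier N"
          using add_right j co[of u j] by auto
        have "h j c = (?a \<oplus>\<^bsub>N\<^esub> ?b) \<oplus>\<^bsub>N\<^esub> \<ominus>\<^bsub>N\<^esub> (?a \<oplus>\<^bsub>N\<^esub> ?b)"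
          using add_right j co[of u j] cl
          by (simp add: h_diff h_of keys_minus_subset N.smult_r_distr N.M.a_assoc N.M.minus_add)
        then show ?thesis using cl by (simp add: N.M.r_neg)
      qed
      then show ?thesis by (rule trivial_family.zero)
    next
      case (smult r u v)
      let ?k = "\<lambda>j. co (r \<odot>\<^bsub>L\<^esub> u) j \<oplus>\<^bsub>R\<^esub> \<ominus>\<^bsub>R\<^esub> (r \<otimes>\<^bsub>R\<^esub> co u j)"
      have cl: "co (r \<odot>\<^bsub>L\<^esub> u) \<in> J \<rightarrow> carrier R" "co u \<in> J \<rightarrow> carrier R"
        using smult coPi by auto
      then have cl': "(\<lambda>j. r \<otimes>\<^bsub>R\<^esub> co u j) \<in> J \<rightarrow> carrier R" "(\<lambda>j. \<ominus>\<^bsub>R\<^esub> (r \<otimes>\<^bsub>R\<^esub> co u j)) \<in> J \<rightarrow> carrier R"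
        using smult by auto
      have "(\<Oplus>\<^bsub>L\<^esub>j\<in>J. ?k j \<odot>\<^bsub>L\<^esub> x j) = \<zero>\<^bsub>L\<^esub>"
        using smult cl x fin
        by (simp add: L.finsum_add_smult cl' L.finsum_uminus_smult L.finsum_mult_smult co_sum L.M.r_neg)
      then have "trivial_family R L N J x (\<lambda>j. ?k j \<odot>\<^bsub>N\<^esub> v)"
        using smult cl by (intro trivial_family_relation) (simp_all add: Pi_iff)
      then show ?thesis
      proof (rule trivial_family_cong)
        fix j assume j: "j \<in> J"
        have "co (r \<odot>\<^bsub>L\<^esub> u) j \<in> carrier R" "co u j \<in> carrier R"
          using j cl by auto
        then show "h j c = ?k j \<odot>\<^bsub>N\<^esub> v"
          using smult j
          by (simp add: h_diff h_of N.smult_l_distr N.smult_l_minus L.R.m_comm[of r] N.smult_assoc1)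
      qed
    qed
  next
    case (add c d)
    show ?case
      by (rule trivial_family_cong[OF trivial_family_add[OF add.IH]])
        (use add.hyps kernel_keys h_add in auto)
  next
    case (uminus c)
    show ?case
      by (rule trivial_family_cong[OF trivial_family_uminus[OF uminus.IH]])
        (use uminus.hyps kernel_keys h_uminus in auto)
  qed
  \<comment> \<open>\<open>e\<close> is the Kronecker delta. For fixed \<open>j\<close>, the
    \<open>k j i\<close> are the coefficients of the relation that equates \<open>x j\<close> with
    its own chosen expansion.\<close>
  define e where "e i j = (if i = j then \<one>\<^bsub>R\<^esub> else \<zero>\<^bsub>R\<^esub>)" for i j :: 'i
  define k where "k j i = e i j \<oplus>\<^bsub>R\<^esub> \<ominus>\<^bsub>R\<^esub> co (x j) i" for i j
  have xj: "x j \<in> carrier L" and mj: "m j \<in> carrier N" if "j \<in> J" for j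
    using x m that by auto
  have e: "e i j \<in> carrier R" for i j by (simp add: e_def)
  have k: "k j i \<in> carrier R" if "i \<in> J" "j \<in> J" for i j
    using that e co xj by (simp add: k_def)
  have h_sum: "h i (\<Sum>j\<in>J'. frag_of (x j, m j)) = (\<Oplus>\<^bsub>N\<^esub>j\<in>J'. co (x j) i \<odot>\<^bsub>N\<^esub> m j)"
    if "finite J'" "J' \<subseteq> J" "i \<in> J" for J' i
    using that(1,2)
  proof (induction J' rule: finite_induct)
    case empty
    then show ?case using h_0 that by simp
  next
    case (insert j J')
    have "Poly_Mapping.keys (\<Sum>j\<in>J'. frag_of (x j, m j)) \<subseteq> ?S"
      unfolding carrier_free_Abelian_group_iff[symmetric]
      by (rule sum_closed_free_Abelian_group) (use insert.prems xj mj in \<open>simp add: subset_iff\<close>)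
    moreover have "(\<lambda>j. co (x j) i \<odot>\<^bsub>N\<^esub> m j) \<in> J' \<rightarrow> carrier N"
      using insert.prems that(3) xj mj co by (simp add: Pi_iff subset_iff)
    ultimately show ?case
      using insert that(3) xj mj co by (simp add: h_add h_of)
  qed
  have "trivial_family R L N J x (\<lambda>i. k j i \<odot>\<^bsub>N\<^esub> m j)" if j: "j \<in> J" for j
  proof (rule trivial_family_relation)
    have "(\<Oplus>\<^bsub>L\<^esub>i\<in>J. k j i \<odot>\<^bsub>L\<^esub> x i)
      = (\<Oplus>\<^bsub>L\<^esub>i\<in>J. e i j \<odot>\<^bsub>L\<^esub> x i) \<oplus>\<^bsub>L\<^esub> \<ominus>\<^bsub>L\<^esub> (\<Oplus>\<^bsub>L\<^esub>i\<in>J. co (x j) i \<odot>\<^bsub>L\<^esub> x i)"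
      unfolding k_def L.finsum_uminus_smult[OF fin coPi[OF xj[OF j]] x, symmetric]
      using e coPi[OF xj[OF j]] x by (intro L.finsum_add_smult) (simp_all add: Pi_iff)
    then show "(\<Oplus>\<^bsub>L\<^esub>i\<in>J. k j i \<odot>\<^bsub>L\<^esub> x i) = \<zero>\<^bsub>L\<^esub>"
      using L.finsum_delta[OF fin j x, of "\<one>\<^bsub>R\<^esub>"] xj[OF j] by (simp add: e_def co_sum L.M.r_neg)
  qed (use k j mj in \<open>simp_all add: Pi_iff\<close>)
  then have "trivial_family R L N J x (\<lambda>i. \<Oplus>\<^bsub>N\<^esub>j\<in>J. k j i \<odot>\<^bsub>N\<^esub> m j)"
    by (rule trivial_family_sum[OF fin])
  \<comment> \<open>The value of \<open>h i\<close> on the given sum is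
    \<open>\<Sum>j. co (x j) i m j\<close>. Adding \<open>\<Sum>j. k j i m j\<close> replaces these
    coefficients by the delta and leaves \<open>m i\<close>.\<close>
  from trivial_family_add[OF this h_kernel[OF kernel]] show ?thesis
  proof (rule trivial_family_cong)
    fix i assume i: "i \<in> J"
    have ei: "e i \<in> J \<rightarrow> carrier R" and coi: "(\<lambda>j. co (x j) i) \<in> J \<rightarrow> carrier R"
      using e co xj i by auto
    have "(\<Oplus>\<^bsub>N\<^esub>j\<in>J. e i j \<odot>\<^bsub>N\<^esub> m j) = m i"
      using N.finsum_delta[OF fin i m, of "\<one>\<^bsub>R\<^esub>"] mj[OF i] by (simp add: e_def eq_commute[of i])
    then have "(\<Oplus>\<^bsub>N\<^esub>j\<in>J. k j i \<odot>\<^bsub>N\<^esub> m j) = m i \<oplus>\<^bsub>N\<^esub> \<ominus>\<^bsub>N\<^esub> (\<Oplus>\<^bsub>N\<^esub>j\<in>J. co (x j) i \<odot>\<^bsub>N\<^esub> m j)"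
      unfolding k_def N.finsum_uminus_smult[OF fin coi m, symmetric]
      using N.finsum_add_smult[OF ei _ m] coi by (simp add: Pi_iff)
    then show "m i = (\<Oplus>\<^bsub>N\<^esub>j\<in>J. k j i \<odot>\<^bsub>N\<^esub> m j) \<oplus>\<^bsub>N\<^esub> h i (\<Sum>j\<in>J. frag_of (x j, m j))"
      using h_sum[OF fin subset_refl i] mj[OF i] N.finsum_smult_closed[OF coi m]
      by (simp add: N.M.a_assoc N.M.l_neg)
  qed
qed

end

section \<open>Flatness\<close>

text \<open>The ring as a module over itself, moved into the type in which
  \<open>flat_module\<close> takes its test modules. On carrier elements,
  \<open>hd (the_elem X)\<close> reads the ring element back.\<close>

definition list_copy :: "('r, 'a) ring_scheme \<Rightarrow> ('r, 'r list set) module"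
  where "list_copy R =
    \<lparr>carrier = (\<lambda>r. {[r]}) ` carrier R, monoid.mult = undefined, one = undefined,
     ring.zero = {[\<zero>\<^bsub>R\<^esub>]}, ring.add = (\<lambda>X Y. {[hd (the_elem X) \<oplus>\<^bsub>R\<^esub> hd (the_elem Y)]}),
     smult = (\<lambda>r X. {[r \<otimes>\<^bsub>R\<^esub> hd (the_elem X)]})\<rparr>"

lemma list_copy_simps [simp]:
  "carrier (list_copy R) = (\<lambda>r. {[r]}) ` carrier R"
  "\<zero>\<^bsub>list_copy R\<^esub> = {[\<zero>\<^bsub>R\<^esub>]}"
  "{[r]} \<oplus>\<^bsub>list_copy R\<^esub> {[s]} = {[r \<oplus>\<^bsub>R\<^esub> s]}"
  "r \<odot>\<^bsub>list_copy R\<^esub> {[s]} = {[r \<otimes>\<^bsub>R\<^esub> s]}"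
  by (simp_all add: list_copy_def)

context cring
begin

lemma list_copy_module: "module R (list_copy R)"
proof (rule moduleI)
  show "abelian_group (list_copy R)"
  proof (rule abelian_groupI)
    fix X assume "X \<in> carrier (list_copy R)"
    then show "\<exists>Y\<in>carrier (list_copy R). Y \<oplus>\<^bsub>list_copy R\<^esub> X = \<zero>\<^bsub>list_copy R\<^esub>"
      by (auto intro!: bexI[of _ "\<ominus> _"] simp: l_neg)
  qed (auto simp: a_ac)
qed (auto simp: is_cring l_distr r_distr m_assoc)

lemma list_copy_finsum:
  assumes "finite T" "f \<in> T \<rightarrow> carrier R"
  shows "(\<Oplus>\<^bsub>list_copy R\<^esub>t\<in>T. {[f t]}) = {[\<Oplus>t\<in>T. f t]}"
  using assms
proof (induction T rule: finite_induct)
  case empty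
  interpret C: module R "list_copy R" by (rule list_copy_module)
  show ?case by simp
next
  case (insert i T)
  interpret C: module R "list_copy R" by (rule list_copy_module)
  have "(\<lambda>t. {[f t]}) \<in> T \<rightarrow> carrier (list_copy R)" using insert.prems by auto
  then have "(\<Oplus>\<^bsub>list_copy R\<^esub>t\<in>insert i T. {[f t]})
      = {[f i]} \<oplus>\<^bsub>list_copy R\<^esub> (\<Oplus>\<^bsub>list_copy R\<^esub>t\<in>T. {[f t]})"
    using insert.hyps insert.prems by (intro C.M.finsum_insert) auto
  also have "\<dots> = {[f i \<oplus> (\<Oplus>t\<in>T. f t)]}" using insert by simp
  also have "f i \<oplus> (\<Oplus>t\<in>T. f t) = (\<Oplus>t\<in>insert i T. f t)"
    using insert.hyps insert.prems by (intro finsum_insert[symmetric]) auto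
  finally show ?case .
qed

end

text \<open>The test map is the inclusion into \<open>R\<close> of the ideal generated by the coefficients.\<close>

lemma flat_equational:
  fixes a :: "'i \<Rightarrow> 'r" and R :: "('r, 'a) ring_scheme" and N :: "('r, 'n, 'd) module_scheme"
  assumes "cring R" and flat: "flat_module R N" and fin: "finite T"
    and a: "a \<in> T \<rightarrow> carrier R" and y: "y \<in> T \<rightarrow> carrier N"
    and rel: "(\<Oplus>\<^bsub>N\<^esub>t\<in>T. a t \<odot>\<^bsub>N\<^esub> y t) = \<zero>\<^bsub>N\<^esub>"
  obtains n :: nat and b w where "w \<in> {..<n} \<rightarrow> carrier N"
    and "\<And>t s. \<lbrakk>t \<in> T; s < n\<rbrakk> \<Longrightarrow> b t s \<in> carrier R"
    and "\<And>t. t \<in> T \<Longrightarrow> y t = (\<Oplus>\<^bsub>N\<^esub>s\<in>{..<n}. b t s \<odot>\<^bsub>N\<^esub> w s)"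
    and "\<And>s. s < n \<Longrightarrow> (\<Oplus>\<^bsub>R\<^esub>t\<in>T. b t s \<otimes>\<^bsub>R\<^esub> a t) = \<zero>\<^bsub>R\<^esub>"
proof -
  interpret R: cring R by fact
  let ?C = "list_copy R"
  define x where "x t = {[a t]}" for t
  \<comment> \<open>The copy of the ideal generated by the \<open>a t\<close>.\<close>
  define H where "H = {\<Oplus>\<^bsub>?C\<^esub>t\<in>T. c t \<odot>\<^bsub>?C\<^esub> x t | c. c \<in> T \<rightarrow> carrier R}"
  let ?D = "?C\<lparr>carrier := H\<rparr>"
  have modN: "module R N" using flat by (simp add: flat_module_def)
  have modC: "module R ?C" by (rule R.list_copy_module)
  interpret C: tensor_pair R ?C N by (rule tensor_pair.intro[OF modC modN])
  have xC: "x \<in> T \<rightarrow> carrier ?C" using a by (auto simp: x_def)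
  have sub: "submodule H R ?C"
    unfolding H_def by (rule C.L.combinations_submodule[OF fin xC])
  have modD: "module R ?D" by (rule submodule.submodule_is_module[OF sub modC])
  interpret D: tensor_pair R ?D N by (rule tensor_pair.intro[OF modD modN])
  have HC: "H \<subseteq> carrier ?C" by (rule C.L.submoduleE(1)[OF sub])
  have xH: "x t \<in> H" if "t \<in> T" for t
  proof -
    have "x t = (\<Oplus>\<^bsub>?C\<^esub>i\<in>T. (if i = t then \<one>\<^bsub>R\<^esub> else \<zero>\<^bsub>R\<^esub>) \<odot>\<^bsub>?C\<^esub> x i)"
      using C.L.finsum_delta[OF fin that xC, of "\<one>\<^bsub>R\<^esub>"] xC that by (simp add: Pi_iff)
    then show ?thesis
      unfolding H_def by (intro CollectI exI[of _ "\<lambda>i. if i = t then \<one>\<^bsub>R\<^esub> else \<zero>\<^bsub>R\<^esub>"] conjI) auto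
  qed
  \<comment> \<open>The tensor \<open>\<Sum>t. a t \<otimes> y t\<close> over the ideal. Over all of
    \<open>R\<close> the coefficients can be moved to the right, where \<open>rel\<close> makes it
    \<open>1 \<otimes> 0\<close>; injectivity then brings the vanishing back to the ideal.\<close>
  let ?e = "\<Sum>t\<in>T. frag_of (x t, y t)"
  have keysD: "Poly_Mapping.keys ?e \<subseteq> carrier ?D \<times> carrier N"
    unfolding carrier_free_Abelian_group_iff[symmetric]
    by (rule sum_closed_free_Abelian_group) (use xH y in \<open>simp add: Pi_iff\<close>)
  have keysC: "Poly_Mapping.keys ?e \<subseteq> carrier ?C \<times> carrier N"
    using keysD HC by auto
  have "C.teq ?e (\<Sum>t\<in>T. frag_of ({[\<one>\<^bsub>R\<^esub>]}, a t \<odot>\<^bsub>N\<^esub> y t))"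
  proof (rule C.teq_sum)
    fix t assume t: "t \<in> T"
    then have at: "a t \<in> carrier R" "y t \<in> carrier N" using a y by auto
    then have "x t = a t \<odot>\<^bsub>?C\<^esub> {[\<one>\<^bsub>R\<^esub>]}" by (simp add: x_def)
    then show "C.teq (frag_of (x t, y t)) (frag_of ({[\<one>\<^bsub>R\<^esub>]}, a t \<odot>\<^bsub>N\<^esub> y t))"
      using C.pure_smult[of "a t" "{[\<one>\<^bsub>R\<^esub>]}" "y t"] at by simp
  qed
  also have "C.teq \<dots> (frag_of ({[\<one>\<^bsub>R\<^esub>]}, \<Oplus>\<^bsub>N\<^esub>t\<in>T. a t \<odot>\<^bsub>N\<^esub> y t))"
    using a y fin by (intro C.teq_sym[OF C.pure_sum_right]) (auto simp: Pi_iff)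
  also have "C.teq \<dots> 0"
    unfolding rel by (rule C.pure_zero_right) simp
  finally have eC: "?e \<in> C.kernel" by (simp add: C.teq_0_iff)
  have f: "(\<lambda>X. X) \<in> linear_maps R ?D ?C" and g: "(\<lambda>v. v) \<in> linear_maps R N N"
    using HC by (auto simp: linear_maps_def hom_def)
  \<comment> \<open>On representatives the induced map is the identity; only the subgroup of
    relations grows from \<open>D.kernel\<close> to \<open>C.kernel\<close>.\<close>
  have map: "tensor_map R ?C N (\<lambda>X. X) (\<lambda>v. v) (D.kernel #>\<^bsub>D.free\<^esub> c) = C.kernel #>\<^bsub>C.free\<^esub> c"
    if "Poly_Mapping.keys c \<subseteq> carrier ?D \<times> carrier N" for c
  proof -
    have "frag_map (\<lambda>X. X) (\<lambda>v. v) c = c"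
      using frag_expansion[of c] by (simp add: frag_map_def case_prod_beta')
    then show ?thesis
      using tensor_map_coset[OF D.tensor_pair_axioms C.tensor_pair_axioms f g that] by simp
  qed
  have inj: "inj_on (tensor_map R ?C N (\<lambda>X. X) (\<lambda>v. v)) (carrier (tensor_group R ?D N))"
  proof -
    have "inj_on (\<lambda>X. X) (carrier ?D)" by simp
    then show ?thesis using flat f modD modC unfolding flat_module_def by blast
  qed
  have coset: "D.kernel #>\<^bsub>D.free\<^esub> c \<in> carrier (tensor_group R ?D N)"
    if "Poly_Mapping.keys c \<subseteq> carrier ?D \<times> carrier N" for c
    using that by (auto simp: tensor_group_def FactGroup_def RCOSETS_def)
  have "C.kernel #>\<^bsub>C.free\<^esub> ?e = C.kernel #>\<^bsub>C.free\<^esub> 0"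
    using eC keysC by (subst C.coset_eq_iff) (simp_all add: C.teq_0_iff)
  then have "D.kernel #>\<^bsub>D.free\<^esub> ?e = D.kernel #>\<^bsub>D.free\<^esub> 0"
    using inj_onD[OF inj _ coset[OF keysD] coset[of 0]] map[OF keysD] map[of 0] by simp
  then have "?e \<in> D.kernel"
    using keysD by (subst (asm) D.coset_eq_iff) (simp_all add: D.teq_0_iff)
  \<comment> \<open>The family \<open>x\<close> generates \<open>?D\<close> by construction, as
    \<open>trivial_family_if_kernel\<close> demands. In \<open>?C\<close> it need not generate, so
    the vanishing is exploited over the ideal.\<close>
  moreover have "\<exists>c\<in>T \<rightarrow> carrier R. u = (\<Oplus>\<^bsub>?D\<^esub>t\<in>T. c t \<odot>\<^bsub>?D\<^esub> x t)" if u: "u \<in> carrier ?D" for u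
  proof -
    obtain c where c: "c \<in> T \<rightarrow> carrier R" "u = (\<Oplus>\<^bsub>?C\<^esub>t\<in>T. c t \<odot>\<^bsub>?C\<^esub> x t)"
      using u by (auto simp: H_def)
    have "(\<lambda>t. c t \<odot>\<^bsub>?C\<^esub> x t) \<in> T \<rightarrow> H"
      using c(1) xH C.L.submoduleE(4)[OF sub] by auto
    from C.L.finsum_submodule[OF sub this] show ?thesis
      using c by (intro bexI[of _ c]) simp_all
  qed
  ultimately have "trivial_family R ?D N T x y"
    using fin xH y by (intro D.trivial_family_if_kernel) auto
  then obtain n :: nat and b w where w: "w \<in> {..<n} \<rightarrow> carrier N"
    and b: "\<And>t s. \<lbrakk>t \<in> T; s < n\<rbrakk> \<Longrightarrow> b t s \<in> carrier R"
    and yb: "\<And>t. t \<in> T \<Longrightarrow> y t = (\<Oplus>\<^bsub>N\<^esub>s\<in>{..<n}. b t s \<odot>\<^bsub>N\<^esub> w s)"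
    and rel': "\<And>s. s < n \<Longrightarrow> (\<Oplus>\<^bsub>?D\<^esub>t\<in>T. b t s \<odot>\<^bsub>?D\<^esub> x t) = \<zero>\<^bsub>?D\<^esub>"
    by (rule D.trivial_familyE) blast
  have "(\<Oplus>\<^bsub>R\<^esub>t\<in>T. b t s \<otimes>\<^bsub>R\<^esub> a t) = \<zero>\<^bsub>R\<^esub>" if s: "s < n" for s
  proof -
    have "(\<lambda>t. b t s \<odot>\<^bsub>?C\<^esub> x t) \<in> T \<rightarrow> H"
      using b s xH C.L.submoduleE(4)[OF sub] by auto
    from C.L.finsum_submodule[OF sub this]
    have "(\<Oplus>\<^bsub>?C\<^esub>t\<in>T. b t s \<odot>\<^bsub>?C\<^esub> x t) = {[\<zero>\<^bsub>R\<^esub>]}"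
      using rel'[OF s] by simp
    moreover have "(\<Oplus>\<^bsub>?C\<^esub>t\<in>T. b t s \<odot>\<^bsub>?C\<^esub> x t) = {[\<Oplus>\<^bsub>R\<^esub>t\<in>T. b t s \<otimes>\<^bsub>R\<^esub> a t]}"
      unfolding x_def list_copy_simps(4) using fin b[OF _ s] a
      by (intro R.list_copy_finsum) (auto simp: Pi_iff)
    ultimately show ?thesis by simp
  qed
  with w b yb show thesis by (rule that)
qed

context tensor_pair
begin

text \<open>Row \<open>i\<close> of the matrix gives the relation
  \<open>\<Sum>t. a i t y t = m i = 0\<close> in \<open>N\<close>. The equational criterion
  expresses the \<open>y t\<close> through elements \<open>w s\<close> such that row
  \<open>i\<close> of the new matrix is zero. Then \<open>x i\<close> has coefficient 0 in every
  column and can be omitted.\<close>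

lemma trivial_family_drop_zero:
  assumes flat: "flat_module R N" and fin: "finite J" and i: "i \<notin> J"
    and x: "x \<in> insert i J \<rightarrow> carrier L"
    and triv: "trivial_family R L N (insert i J) x m" and mi: "m i = \<zero>\<^bsub>N\<^esub>"
  shows "trivial_family R L N J x m"
proof -
  obtain n :: nat and a y where y: "y \<in> {..<n} \<rightarrow> carrier N"
    and a: "\<And>j t. \<lbrakk>j \<in> insert i J; t < n\<rbrakk> \<Longrightarrow> a j t \<in> carrier R"
    and m: "\<And>j. j \<in> insert i J \<Longrightarrow> m j = (\<Oplus>\<^bsub>N\<^esub>t\<in>{..<n}. a j t \<odot>\<^bsub>N\<^esub> y t)"
    and rel: "\<And>t. t < n \<Longrightarrow> (\<Oplus>\<^bsub>L\<^esub>j\<in>insert i J. a j t \<odot>\<^bsub>L\<^esub> x j) = \<zero>\<^bsub>L\<^esub>"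
    using triv by (rule trivial_familyE) blast
  have "a i \<in> {..<n} \<rightarrow> carrier R" "(\<Oplus>\<^bsub>N\<^esub>t\<in>{..<n}. a i t \<odot>\<^bsub>N\<^esub> y t) = \<zero>\<^bsub>N\<^esub>"
    using a mi m[of i] by auto
  then obtain n' :: nat and b w where w: "w \<in> {..<n'} \<rightarrow> carrier N"
    and b: "\<And>t s. \<lbrakk>t \<in> {..<n}; s < n'\<rbrakk> \<Longrightarrow> b t s \<in> carrier R"
    and yb: "\<And>t. t \<in> {..<n} \<Longrightarrow> y t = (\<Oplus>\<^bsub>N\<^esub>s\<in>{..<n'}. b t s \<odot>\<^bsub>N\<^esub> w s)"
    and rel': "\<And>s. s < n' \<Longrightarrow> (\<Oplus>\<^bsub>R\<^esub>t\<in>{..<n}. b t s \<otimes>\<^bsub>R\<^esub> a i t) = \<zero>\<^bsub>R\<^esub>"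
    by (rule flat_equational[OF L.is_cring flat finite_lessThan _ y]) (rule that)
  \<comment> \<open>The coefficients of \<open>m j\<close> after the \<open>y t\<close> have been
    replaced by combinations of the \<open>w s\<close>; row \<open>i\<close> vanishes by
    \<open>rel'\<close>.\<close>
  let ?a = "\<lambda>j s. \<Oplus>\<^bsub>R\<^esub>t\<in>{..<n}. b t s \<otimes>\<^bsub>R\<^esub> a j t"
  have cl: "(\<lambda>t. b t s \<otimes>\<^bsub>R\<^esub> a j t) \<in> {..<n} \<rightarrow> carrier R" if "j \<in> insert i J" "s < n'" for j s
    using a[OF that(1)] b[OF _ that(2)] by (simp add: Pi_iff)
  have acl: "?a j s \<in> carrier R" if "j \<in> insert i J" "s < n'" for j s
    using cl[OF that] by (rule L.R.finsum_closed)
  show ?thesis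
  proof (rule trivial_familyI[where T = "{..<n'}" and a = ?a and y = w])
    fix j assume j: "j \<in> J"
    have aj: "a j \<in> {..<n} \<rightarrow> carrier R" using a j by auto
    have "m j = (\<Oplus>\<^bsub>N\<^esub>t\<in>{..<n}. a j t \<odot>\<^bsub>N\<^esub> (\<Oplus>\<^bsub>N\<^esub>s\<in>{..<n'}. b t s \<odot>\<^bsub>N\<^esub> w s))"
      using m[of j] j y aj by (simp add: yb[symmetric] Pi_iff cong: N.M.finsum_cong)
    also have "\<dots> = (\<Oplus>\<^bsub>N\<^esub>s\<in>{..<n'}. (\<Oplus>\<^bsub>R\<^esub>t\<in>{..<n}. a j t \<otimes>\<^bsub>R\<^esub> b t s) \<odot>\<^bsub>N\<^esub> w s)"
      using aj b w by (intro N.finsum_smult_swap[symmetric]) auto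
    also have "\<dots> = (\<Oplus>\<^bsub>N\<^esub>s\<in>{..<n'}. ?a j s \<odot>\<^bsub>N\<^esub> w s)"
    proof (rule N.M.finsum_cong')
      fix s assume "s \<in> {..<n'}"
      then have s: "s < n'" by simp
      have "(\<Oplus>\<^bsub>R\<^esub>t\<in>{..<n}. a j t \<otimes>\<^bsub>R\<^esub> b t s) = ?a j s"
        using cl[OF _ s, of j] aj b[OF _ s] j by (intro L.R.finsum_cong') (auto simp: L.R.m_comm Pi_iff)
      then show "(\<Oplus>\<^bsub>R\<^esub>t\<in>{..<n}. a j t \<otimes>\<^bsub>R\<^esub> b t s) \<odot>\<^bsub>N\<^esub> w s = ?a j s \<odot>\<^bsub>N\<^esub> w s" by simp
    qed (use acl j w in \<open>auto simp: Pi_iff\<close>)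
    finally show "m j = (\<Oplus>\<^bsub>N\<^esub>s\<in>{..<n'}. ?a j s \<odot>\<^bsub>N\<^esub> w s)" .
  next
    fix s assume "s \<in> {..<n'}"
    then have s: "s < n'" by simp
    have xi: "x i \<in> carrier L" and xJ: "x \<in> J \<rightarrow> carrier L" using x by auto
    have sc: "(\<lambda>j. ?a j s \<odot>\<^bsub>L\<^esub> x j) \<in> J \<rightarrow> carrier L"
      using acl s xJ by (auto simp: Pi_iff)
    have "(\<Oplus>\<^bsub>L\<^esub>j\<in>J. ?a j s \<odot>\<^bsub>L\<^esub> x j) = (\<Oplus>\<^bsub>L\<^esub>j\<in>insert i J. ?a j s \<odot>\<^bsub>L\<^esub> x j)"
      using L.M.finsum_insert[OF fin i sc] L.M.finsum_closed[OF sc] rel'[OF s] xi by simp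
    also have "\<dots> = (\<Oplus>\<^bsub>L\<^esub>t\<in>{..<n}. b t s \<odot>\<^bsub>L\<^esub> (\<Oplus>\<^bsub>L\<^esub>j\<in>insert i J. a j t \<odot>\<^bsub>L\<^esub> x j))"
      using a b s x by (intro L.finsum_smult_swap) auto
    also have "\<dots> = (\<Oplus>\<^bsub>L\<^esub>t\<in>{..<n}. \<zero>\<^bsub>L\<^esub>)"
      using b s by (intro L.M.finsum_cong') (simp_all add: rel)
    finally show "(\<Oplus>\<^bsub>L\<^esub>j\<in>J. ?a j s \<odot>\<^bsub>L\<^esub> x j) = \<zero>\<^bsub>L\<^esub>" by simp
  qed (use acl w in auto)
qed

lemma trivial_family_drop_zeros:
  assumes flat: "flat_module R N" and fin: "finite G" "finite J" and "J \<inter> G = {}"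
    and "x \<in> J \<union> G \<rightarrow> carrier L" and "trivial_family R L N (J \<union> G) x m"
    and "\<And>i. i \<in> G \<Longrightarrow> m i = \<zero>\<^bsub>N\<^esub>"
  shows "trivial_family R L N J x m"
  using fin(1) assms(4-)
proof (induction G rule: finite_induct)
  case empty
  then show ?case by simp
next
  case (insert i G)
  have "trivial_family R L N (J \<union> G) x m"
  proof (rule trivial_family_drop_zero[OF flat])
    show "i \<notin> J \<union> G" "x \<in> insert i (J \<union> G) \<rightarrow> carrier L"
      "trivial_family R L N (insert i (J \<union> G)) x m"
      using insert.prems insert.hyps by auto
  qed (use insert.prems insert.hyps fin(2) in auto)
  then show ?case
    using insert.prems by (intro insert.IH) (auto simp: Pi_iff)
qed

text \<open>Append generators of \<open>L\<close>, with second components 0, to the family, and then remove them one by one.\<close>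

lemma trivial_family_if_kernel_flat:
  fixes J :: "nat set"
  assumes flat: "flat_module R N" and fg: "fg_module R L"
    and fin: "finite J" and x: "x \<in> J \<rightarrow> carrier L" and m: "m \<in> J \<rightarrow> carrier N"
    and kernel: "(\<Sum>j\<in>J. frag_of (x j, m j)) \<in> kernel"
  shows "trivial_family R L N J x m"
proof -
  obtain B where B: "finite B" "B \<subseteq> carrier L"
    and gen: "\<And>u. u \<in> carrier L \<Longrightarrow> \<exists>c\<in>B \<rightarrow> carrier R. u = (\<Oplus>\<^bsub>L\<^esub>b\<in>B. c b \<odot>\<^bsub>L\<^esub> b)"
    using fg unfolding fg_module_def by blast
  \<comment> \<open>Indices are natural numbers in order to leave room for fresh ones:
    \<open>G\<close> provides one for each generator in \<open>B\<close>.\<close>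
  have "infinite (UNIV - J)" using fin by simp
  then obtain G where G: "G \<subseteq> UNIV - J" "finite G" "card G = card B"
    by (rule infinite_arbitrarily_large[THEN exE]) blast
  then obtain g where g: "bij_betw g G B"
    using B(1) finite_same_card_bij by blast
  have disj: "J \<inter> G = {}" using G by auto
  define x' where "x' j = (if j \<in> J then x j else g j)" for j
  define m' where "m' j = (if j \<in> J then m j else \<zero>\<^bsub>N\<^esub>)" for j
  have x'G: "x' j = g j" "g j \<in> carrier L" if "j \<in> G" for j
    using that disj g B(2) by (auto simp: x'_def bij_betw_def)
  have x': "x' \<in> J \<union> G \<rightarrow> carrier L"
    using x x'G by (auto simp: x'_def Pi_iff)
  have m': "m' \<in> J \<union> G \<rightarrow> carrier N"
    using m by (auto simp: m'_def Pi_iff)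
  have "(\<Sum>j\<in>J \<union> G. frag_of (x' j, m' j)) = (\<Sum>j\<in>J. frag_of (x' j, m' j)) + (\<Sum>j\<in>G. frag_of (x' j, m' j))"
    using fin G(2) disj by (rule sum.union_disjoint)
  also have "(\<Sum>j\<in>J. frag_of (x' j, m' j)) = (\<Sum>j\<in>J. frag_of (x j, m j))"
    by (simp add: x'_def m'_def)
  also have "(\<Sum>j\<in>J. frag_of (x j, m j)) + (\<Sum>j\<in>G. frag_of (x' j, m' j)) \<doteq> 0 + (\<Sum>j\<in>G. 0)"
  proof (intro teq_add teq_sum)
    fix j assume "j \<in> G"
    then show "frag_of (x' j, m' j) \<doteq> 0"
      using disj x'G[of j] pure_zero_right[of "x' j"] by (auto simp: m'_def)
  qed (simp add: teq_0_iff kernel)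
  finally have "(\<Sum>j\<in>J \<union> G. frag_of (x' j, m' j)) \<in> kernel"
    by (simp add: teq_0_iff)
  moreover have "\<exists>c\<in>J \<union> G \<rightarrow> carrier R. u = (\<Oplus>\<^bsub>L\<^esub>j\<in>J \<union> G. c j \<odot>\<^bsub>L\<^esub> x' j)"
    if u: "u \<in> carrier L" for u
  proof -
    obtain c where c: "c \<in> B \<rightarrow> carrier R" "u = (\<Oplus>\<^bsub>L\<^esub>b\<in>B. c b \<odot>\<^bsub>L\<^esub> b)"
      using gen[OF u] by blast
    \<comment> \<open>The appended generators alone already reach \<open>u\<close>, so the original
      \<open>x j\<close> get coefficient zero.\<close>
    define c' where "c' j = (if j \<in> J then \<zero>\<^bsub>R\<^esub> else c (g j))" for j
    have c': "c' \<in> J \<union> G \<rightarrow> carrier R"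
      using c(1) g by (auto simp: c'_def bij_betw_def)
    have "(\<Oplus>\<^bsub>L\<^esub>b\<in>g ` G. c b \<odot>\<^bsub>L\<^esub> b) = (\<Oplus>\<^bsub>L\<^esub>j\<in>G. c (g j) \<odot>\<^bsub>L\<^esub> g j)"
      using g B(2) c(1) by (intro L.M.finsum_reindex) (auto simp: bij_betw_def)
    also have "\<dots> = (\<Oplus>\<^bsub>L\<^esub>j\<in>J \<union> G. c' j \<odot>\<^bsub>L\<^esub> x' j)"
      using fin G(2) disj x'G x' c'
      by (intro L.M.add.finprod_mono_neutral_cong_left) (auto simp: c'_def Pi_iff)
    finally have "u = (\<Oplus>\<^bsub>L\<^esub>j\<in>J \<union> G. c' j \<odot>\<^bsub>L\<^esub> x' j)"
      using c(2) g by (simp add: bij_betw_def)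
    with c' show ?thesis by (intro bexI[of _ c'])
  qed
  ultimately have "trivial_family R L N (J \<union> G) x' m'"
    using fin G(2) x' m' by (intro trivial_family_if_kernel) auto
  then have triv: "trivial_family R L N J x' m'"
    using disj by (intro trivial_family_drop_zeros[OF flat G(2) fin disj x']) (auto simp: m'_def)
  obtain n :: nat and a y where y: "y \<in> {..<n} \<rightarrow> carrier N"
    and a: "\<And>j t. \<lbrakk>j \<in> J; t < n\<rbrakk> \<Longrightarrow> a j t \<in> carrier R"
    and my: "\<And>j. j \<in> J \<Longrightarrow> m' j = (\<Oplus>\<^bsub>N\<^esub>t\<in>{..<n}. a j t \<odot>\<^bsub>N\<^esub> y t)"
    and rel: "\<And>t. t < n \<Longrightarrow> (\<Oplus>\<^bsub>L\<^esub>j\<in>J. a j t \<odot>\<^bsub>L\<^esub> x' j) = \<zero>\<^bsub>L\<^esub>"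
    using triv by (rule trivial_familyE) blast
  show ?thesis
  proof (rule trivial_familyI[where T = "{..<n}" and a = a and y = y])
    fix t assume "t \<in> {..<n}"
    then have t: "t < n" by simp
    have "(\<Oplus>\<^bsub>L\<^esub>j\<in>J. a j t \<odot>\<^bsub>L\<^esub> x j) = (\<Oplus>\<^bsub>L\<^esub>j\<in>J. a j t \<odot>\<^bsub>L\<^esub> x' j)"
      using a[OF _ t] x by (intro L.M.finsum_cong') (auto simp: x'_def Pi_iff)
    with rel[OF t] show "(\<Oplus>\<^bsub>L\<^esub>j\<in>J. a j t \<odot>\<^bsub>L\<^esub> x j) = \<zero>\<^bsub>L\<^esub>" by simp
  qed (use y a my in \<open>auto simp: m'_def\<close>)
qed

text \<open>Moving a coefficient matrix across the tensor sign trades the first components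
  \<open>x j\<close> for linear combinations of them. This is how a trivial family leads to a new
  representation of a tensor.\<close>

lemma pure_sum_swap:
  assumes "finite J" "finite T" "x \<in> J \<rightarrow> carrier L" "w \<in> T \<rightarrow> carrier N"
    and a: "\<And>j t. \<lbrakk>j \<in> J; t \<in> T\<rbrakk> \<Longrightarrow> a j t \<in> carrier R"
  shows "(\<Sum>j\<in>J. frag_of (x j, \<Oplus>\<^bsub>N\<^esub>t\<in>T. a j t \<odot>\<^bsub>N\<^esub> w t))
    \<doteq> (\<Sum>t\<in>T. frag_of (\<Oplus>\<^bsub>L\<^esub>j\<in>J. a j t \<odot>\<^bsub>L\<^esub> x j, w t))"
proof -
  have xj: "x j \<in> carrier L" if "j \<in> J" for j using that assms(3) by auto
  have wt: "w t \<in> carrier N" if "t \<in> T" for t using that assms(4) by auto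
  have "(\<Sum>j\<in>J. frag_of (x j, \<Oplus>\<^bsub>N\<^esub>t\<in>T. a j t \<odot>\<^bsub>N\<^esub> w t))
    \<doteq> (\<Sum>j\<in>J. \<Sum>t\<in>T. frag_of (x j, a j t \<odot>\<^bsub>N\<^esub> w t))"
    using assms(2) a xj wt by (intro teq_sum pure_sum_right) auto
  also have "\<dots> \<doteq> (\<Sum>j\<in>J. \<Sum>t\<in>T. frag_of (a j t \<odot>\<^bsub>L\<^esub> x j, w t))"
    using a xj wt by (intro teq_sum teq_sym[OF pure_smult]) auto
  also have "\<dots> = (\<Sum>t\<in>T. \<Sum>j\<in>J. frag_of (a j t \<odot>\<^bsub>L\<^esub> x j, w t))"
    by (rule sum.swap)
  also have "\<dots> \<doteq> (\<Sum>t\<in>T. frag_of (\<Oplus>\<^bsub>L\<^esub>j\<in>J. a j t \<odot>\<^bsub>L\<^esub> x j, w t))"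
    using assms(1) a xj wt by (intro teq_sum teq_sym[OF pure_sum_left]) auto
  finally show ?thesis .
qed

end

section \<open>Strong Krull primes of a tensor product\<close>

context tensor_pair
begin

text \<open>Negative signs are absorbed into the second components, so integer coefficients
  disappear. Lists are used because the same pure tensor may occur several times.\<close>

lemma ex_sum_list_pure:
  assumes "Poly_Mapping.keys c \<subseteq> carrier L \<times> carrier N"
  shows "\<exists>ps. set ps \<subseteq> carrier L \<times> carrier N \<and> c \<doteq> (\<Sum>p\<leftarrow>ps. frag_of p)"
  using assms
proof (induction c rule: frag_induction)
  case zero
  show ?case by (intro exI[of _ "[]"]) simp
next
  case (one p)
  then show ?case by (intro exI[of _ "[p]"]) simp
next
  case (diff a b)
  then obtain ps qs where ps: "set ps \<subseteq> carrier L \<times> carrier N" "a \<doteq> (\<Sum>p\<leftarrow>ps. frag_of p)"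
    and qs: "set qs \<subseteq> carrier L \<times> carrier N" "b \<doteq> (\<Sum>p\<leftarrow>qs. frag_of p)"
    by blast
  let ?neg = "\<lambda>p. (fst p, \<ominus>\<^bsub>N\<^esub> snd p)"
  have neg: "- (\<Sum>p\<leftarrow>qs. frag_of p) \<doteq> (\<Sum>p\<leftarrow>map ?neg qs. frag_of p)"
    using qs(1)
  proof (induction qs)
    case (Cons q qs)
    have "- (\<Sum>p\<leftarrow>q # qs. frag_of p) = - frag_of q + - (\<Sum>p\<leftarrow>qs. frag_of p)"
      by simp
    also have "\<dots> \<doteq> frag_of (?neg q) + (\<Sum>p\<leftarrow>map ?neg qs. frag_of p)"
      using Cons pure_minus_right[of "fst q" "snd q"] by (intro teq_add) (auto intro: teq_sym)
    finally show ?case by simp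
  qed simp
  have "a - b \<doteq> (\<Sum>p\<leftarrow>ps. frag_of p) - (\<Sum>p\<leftarrow>qs. frag_of p)"
    using ps(2) qs(2) by (rule teq_diff)
  also have "\<dots> = (\<Sum>p\<leftarrow>ps. frag_of p) + - (\<Sum>p\<leftarrow>qs. frag_of p)"
    by simp
  also have "\<dots> \<doteq> (\<Sum>p\<leftarrow>ps. frag_of p) + (\<Sum>p\<leftarrow>map ?neg qs. frag_of p)"
    using neg by (intro teq_add teq_refl)
  also have "\<dots> = (\<Sum>p\<leftarrow>ps @ map ?neg qs. frag_of p)"
    by simp
  finally show ?case
    using ps(1) qs(1) by (intro exI[of _ "ps @ map ?neg qs"]) auto
qed

lemma ex_sum_pure:
  assumes "Poly_Mapping.keys c \<subseteq> carrier L \<times> carrier N"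
  obtains n :: nat and x y where "x \<in> {..<n} \<rightarrow> carrier L" "y \<in> {..<n} \<rightarrow> carrier N"
    "c \<doteq> (\<Sum>j<n. frag_of (x j, y j))"
proof -
  obtain ps where ps: "set ps \<subseteq> carrier L \<times> carrier N" "c \<doteq> (\<Sum>p\<leftarrow>ps. frag_of p)"
    using ex_sum_list_pure[OF assms] by blast
  have "(\<Sum>p\<leftarrow>ps. frag_of p) = (\<Sum>j<length ps. frag_of (fst (ps ! j), snd (ps ! j)))"
    by (simp add: sum_list_sum_nth atLeast0LessThan)
  moreover have "ps ! j \<in> carrier L \<times> carrier N" if "j < length ps" for j
    using ps(1) that nth_mem by blast
  ultimately show thesis
    using ps(2) by (intro that[of "\<lambda>j. fst (ps ! j)" "length ps" "\<lambda>j. snd (ps ! j)"])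
      (auto simp: Pi_iff mem_Times_iff)
qed

end

section \<open>Restriction of scalars and annihilators of tensors\<close>

lemma restrict_scalars_simps [simp]:
  "carrier (restrict_scalars \<phi> M) = carrier M"
  "\<zero>\<^bsub>restrict_scalars \<phi> M\<^esub> = \<zero>\<^bsub>M\<^esub>"
  "(\<oplus>\<^bsub>restrict_scalars \<phi> M\<^esub>) = (\<oplus>\<^bsub>M\<^esub>)"
  "r \<odot>\<^bsub>restrict_scalars \<phi> M\<^esub> x = \<phi> r \<odot>\<^bsub>M\<^esub> x"
  by (simp_all add: restrict_scalars_def module_of_group_def)

lemma finsum_restrict_scalars [simp]: "finsum (restrict_scalars \<phi> M) = finsum M"
  by (simp add: finsum_def finprod_def fun_eq_iff)

lemma a_inv_restrict_scalars [simp]: "a_inv (restrict_scalars \<phi> M) = a_inv M"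
  by (simp add: a_inv_def m_inv_def fun_eq_iff)

lemma subgroup_restrict_scalars:
  "subgroup H (add_monoid (restrict_scalars \<phi> M)) \<longleftrightarrow> subgroup H (add_monoid M)"
  by (simp add: subgroup_def m_inv_def)

lemma (in module) ann_ideal:
  assumes "x \<in> carrier M"
  shows "ideal (ann R M x) R"
proof (rule idealI)
  show "subgroup (ann R M x) (add_monoid R)"
    using assms by (intro R.add.subgroupI)
      (auto simp: ann_def smult_l_distr smult_l_minus a_inv_def[symmetric])
  show "a \<otimes> r \<in> ann R M x" if "a \<in> ann R M x" "r \<in> carrier R" for a r
    using that assms smult_assoc1[of r a x] by (simp add: ann_def R.m_comm[of a])
qed (use assms in \<open>auto simp: ann_def smult_assoc1 R.ring_axioms\<close>)

locale flat_extension =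
  R: cring R + S: cring S + L: module R L + M: module S M
  for R :: "('r, 'a) ring_scheme" and S :: "('s, 'b) ring_scheme"
    and \<phi> :: "'r \<Rightarrow> 's" and L :: "('r, 'l, 'c) module_scheme"
    and M :: "('s, 'm, 'd) module_scheme" +
  assumes hom: "\<phi> \<in> ring_hom R S"
    and flat: "flat_module R (restrict_scalars \<phi> M)"
    and fg: "fg_module R L"
begin

abbreviation MR where "MR \<equiv> restrict_scalars \<phi> M"

sublocale T: tensor_pair R L MR
  using flat by (intro tensor_pair.intro L.module_axioms) (simp add: flat_module_def)

notation T.teq (infix \<open>\<doteq>\<close> 50)

lemma phi_closed [simp]: "r \<in> carrier R \<Longrightarrow> \<phi> r \<in> carrier S"
  using hom by (rule ring_hom_closed)

abbreviation act where "act s \<equiv> frag_map (\<lambda>x::'l. x) (\<lambda>y. s \<odot>\<^bsub>M\<^esub> y)"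

text \<open>For \<open>c\<close> supported on the carriers this is the annihilator of the tensor
  represented by \<open>c\<close>, as \<open>ann_tensor_coset\<close> shows.\<close>

definition frag_ann :: "('l \<times> 'm \<Rightarrow>\<^sub>0 int) \<Rightarrow> 's set"
  where "frag_ann c = {s \<in> carrier S. act s c \<in> T.kernel}"

lemma smult_linear: "s \<in> carrier S \<Longrightarrow> (\<lambda>y. s \<odot>\<^bsub>M\<^esub> y) \<in> linear_maps R MR MR"
  by (auto simp: linear_maps_def hom_def M.smult_r_distr M.smult_assoc1[symmetric] S.m_comm)

lemma id_linear: "(\<lambda>x. x) \<in> linear_maps R L L"
  by (simp add: linear_maps_def hom_def)

lemma act_kernel: "\<lbrakk>s \<in> carrier S; c \<in> T.kernel\<rbrakk> \<Longrightarrow> act s c \<in> T.kernel"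
  using frag_map_kernel[OF T.tensor_pair_axioms T.tensor_pair_axioms id_linear smult_linear] .

lemma act_cong: "\<lbrakk>s \<in> carrier S; c \<doteq> d\<rbrakk> \<Longrightarrow> act s c \<doteq> act s d"
  using act_kernel[of s "c - d"] by (simp add: T.teq_def)

lemma frag_ann_cong: "c \<doteq> d \<Longrightarrow> frag_ann c = frag_ann d"
  using act_cong[of _ c d] T.kernel_cong by (auto simp: frag_ann_def)

lemma act_sum: "act s (\<Sum>j\<in>J. frag_of (x j, y j)) = (\<Sum>j\<in>J. frag_of (x j, s \<odot>\<^bsub>M\<^esub> y j))"
  by (simp add: frag_map_sum)

lemma ann_tensor_coset:
  assumes "Poly_Mapping.keys c \<subseteq> carrier L \<times> carrier M"
  shows "ann S (tensor_module R \<phi> L M) (T.kernel #>\<^bsub>T.free\<^esub> c) = frag_ann c"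
proof -
  have "s \<odot>\<^bsub>tensor_module R \<phi> L M\<^esub> (T.kernel #>\<^bsub>T.free\<^esub> c) = T.kernel #>\<^bsub>T.free\<^esub> act s c"
    and "Poly_Mapping.keys (act s c) \<subseteq> carrier L \<times> carrier MR" if "s \<in> carrier S" for s
    using assms that tensor_map_coset[OF T.tensor_pair_axioms T.tensor_pair_axioms id_linear smult_linear]
      keys_frag_map[of c "carrier L" "carrier M" "\<lambda>x. x" "carrier L" "\<lambda>y. s \<odot>\<^bsub>M\<^esub> y" "carrier M"]
    by (simp_all add: tensor_module_def module_of_group_def Pi_iff)
  moreover have "\<zero>\<^bsub>tensor_module R \<phi> L M\<^esub> = T.kernel"
    by (simp add: tensor_module_def module_of_group_def tensor_group_def FactGroup_def)
  ultimately show ?thesis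
    using T.coset_eq_kernel_iff by (simp add: ann_def frag_ann_def cong: conj_cong)
qed

lemma carrier_tensor_module:
  "carrier (tensor_module R \<phi> L M)
    = {T.kernel #>\<^bsub>T.free\<^esub> c | c. Poly_Mapping.keys c \<subseteq> carrier L \<times> carrier M}"
  by (auto simp: tensor_module_def module_of_group_def tensor_group_def FactGroup_def RCOSETS_def)

text \<open>Every element of the tensor module is the coset of a supported formal sum, so from here
  on strong Krull primes can be tested on representatives.\<close>

lemma sK_tensor_iff:
  "\<pp> \<in> sK S (tensor_module R \<phi> L M) \<longleftrightarrow> primeideal \<pp> S \<and>
    (\<forall>I. fg_ideal I S \<and> I \<subseteq> \<pp> \<longrightarrow>
      (\<exists>c. Poly_Mapping.keys c \<subseteq> carrier L \<times> carrier M \<and> I \<subseteq> frag_ann c \<and> frag_ann c \<subseteq> \<pp>))"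
proof -
  have "(\<exists>z\<in>carrier (tensor_module R \<phi> L M). Q (ann S (tensor_module R \<phi> L M) z)) \<longleftrightarrow>
      (\<exists>c. Poly_Mapping.keys c \<subseteq> carrier L \<times> carrier M \<and> Q (frag_ann c))" for Q
  proof -
    have "(\<exists>z\<in>carrier (tensor_module R \<phi> L M). Q (ann S (tensor_module R \<phi> L M) z)) \<longleftrightarrow>
        (\<exists>c. Poly_Mapping.keys c \<subseteq> carrier L \<times> carrier M \<and>
          Q (ann S (tensor_module R \<phi> L M) (T.kernel #>\<^bsub>T.free\<^esub> c)))"
      unfolding carrier_tensor_module by blast
    then show ?thesis using ann_tensor_coset by (metis (no_types, lifting))
  qed
  from this[of "\<lambda>A. _ \<subseteq> A \<and> A \<subseteq> \<pp>"] show ?thesis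
    unfolding sK_def by simp
qed

section \<open>The submodules \<open>\<qq>M\<close> and annihilators in
  \<open>M/\<qq>M\<close>\<close>

abbreviation quot_sub where "quot_sub \<qq> \<equiv> ideal_smult \<qq> MR"

text \<open>The colon ideal \<open>(\<qq>M : m)\<close>, that is, the annihilator of the class of
  \<open>m\<close> in \<open>M/\<qq>M\<close>.\<close>

definition colon :: "'r set \<Rightarrow> 'm \<Rightarrow> 's set"
  where "colon \<qq> m = {s \<in> carrier S. s \<odot>\<^bsub>M\<^esub> m \<in> quot_sub \<qq>}"

lemma smult_in_quot_sub:
  "\<lbrakk>a \<in> \<qq>; m \<in> carrier M\<rbrakk> \<Longrightarrow> \<phi> a \<odot>\<^bsub>M\<^esub> m \<in> quot_sub \<qq>"
  unfolding ideal_smult_def by (rule generate.incl) auto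

lemma quot_sub_subgroup:
  assumes "\<qq> \<subseteq> carrier R"
  shows "subgroup (quot_sub \<qq>) (add_monoid M)"
  unfolding ideal_smult_def subgroup_restrict_scalars[of _ \<phi> M, symmetric]
  by (rule T.N.M.add.generate_is_subgroup) (use assms in auto)

text \<open>No case for negatives is required: \<open>- (\<phi> a x) = \<phi> a (- x)\<close> is
  again a generator.\<close>

lemma quot_sub_induct [consumes 2, case_names zero smult add]:
  assumes q: "\<qq> \<subseteq> carrier R" and m: "m \<in> quot_sub \<qq>"
    and zero: "P \<zero>\<^bsub>M\<^esub>"
    and smult: "\<And>a x. \<lbrakk>a \<in> \<qq>; x \<in> carrier M\<rbrakk> \<Longrightarrow> P (\<phi> a \<odot>\<^bsub>M\<^esub> x)"
    and add: "\<And>x y. \<lbrakk>x \<in> quot_sub \<qq>; y \<in> quot_sub \<qq>; P x; P y\<rbrakk> \<Longrightarrow> P (x \<oplus>\<^bsub>M\<^esub> y)"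
  shows "P m"
  using m unfolding ideal_smult_def
proof (induction rule: generate.induct)
  case one
  then show ?case using zero by simp
next
  case (incl h)
  then show ?case using smult by auto
next
  case (inv h)
  then obtain a x where h: "h = \<phi> a \<odot>\<^bsub>M\<^esub> x" "a \<in> \<qq>" "x \<in> carrier M" by auto
  have "inv\<^bsub>add_monoid MR\<^esub> h = \<ominus>\<^bsub>M\<^esub> h"
    using a_inv_restrict_scalars[of \<phi> M] unfolding a_inv_def by metis
  also have "\<dots> = \<phi> a \<odot>\<^bsub>M\<^esub> (\<ominus>\<^bsub>M\<^esub> x)"
    using h q by (auto simp: M.smult_r_minus)
  finally show ?case using smult[OF h(2), of "\<ominus>\<^bsub>M\<^esub> x"] h(3) by simp
next
  case (eng h1 h2)
  then show ?case using add[of h1 h2] by (simp add: ideal_smult_def)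
qed

text \<open>Although \<open>\<qq>\<close> lies in \<open>R\<close>, the subgroup is stable under
  \<open>S\<close>, because \<open>s\<close> commutes with \<open>\<phi> a\<close> and can be moved
  onto the element of \<open>M\<close>.\<close>

lemma quot_sub_submodule:
  assumes q: "\<qq> \<subseteq> carrier R"
  shows "submodule (quot_sub \<qq>) S M"
proof (rule submodule.intro[OF quot_sub_subgroup[OF q]])
  note sub = quot_sub_subgroup[OF q]
  show "submodule_axioms (quot_sub \<qq>) S M"
  proof
    fix s m assume s: "s \<in> carrier S" and m: "m \<in> quot_sub \<qq>"
    show "s \<odot>\<^bsub>M\<^esub> m \<in> quot_sub \<qq>"
      using q m
    proof (induction rule: quot_sub_induct)
      case zero
      then show ?case using s subgroup.one_closed[OF sub] by simp
    next
      case (smult a x)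
      then have "s \<odot>\<^bsub>M\<^esub> (\<phi> a \<odot>\<^bsub>M\<^esub> x) = \<phi> a \<odot>\<^bsub>M\<^esub> (s \<odot>\<^bsub>M\<^esub> x)"
        using s q by (auto simp: M.smult_assoc1[symmetric] S.m_comm)
      then show ?case using smult s by (simp add: smult_in_quot_sub)
    next
      case (add x y)
      have "x \<in> carrier M" "y \<in> carrier M"
        using subgroup.subset[OF sub] add.hyps by auto
      then show ?case
        using s add.IH subgroup.m_closed[OF sub] by (simp add: M.smult_r_distr)
    qed
  qed
qed

lemma quot_sub_finsum:
  assumes "\<qq> \<subseteq> carrier R" "f \<in> A \<rightarrow> quot_sub \<qq>"
  shows "finsum M f A \<in> quot_sub \<qq>"
proof -
  interpret H: module S "M\<lparr>carrier := quot_sub \<qq>\<rparr>"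
    by (rule submodule.submodule_is_module[OF quot_sub_submodule[OF assms(1)] M.module_axioms])
  show ?thesis
    using H.M.finsum_closed[of f A] M.finsum_submodule[OF quot_sub_submodule[OF assms(1)] assms(2)]
      assms(2) by simp
qed

text \<open>Scalar multiplication in \<open>quotient_module\<close> is a union over representatives.
  All of them give the same coset, since \<open>\<qq>M\<close> is stable under
  \<open>S\<close>.\<close>

lemma ann_quotient_coset:
  assumes q: "\<qq> \<subseteq> carrier R" and m: "m \<in> carrier M"
  shows "ann S (quotient_module M (quot_sub \<qq>)) (quot_sub \<qq> +>\<^bsub>M\<^esub> m) = colon \<qq> m"
proof -
  let ?N = "quot_sub \<qq>"
  note sub = quot_sub_submodule[OF q]
  note N = M.submoduleE[OF sub]
  have sg: "subgroup ?N (add_monoid M)" by (rule submodule.axioms(1)[OF sub])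
  have "s \<odot>\<^bsub>quotient_module M ?N\<^esub> (?N +>\<^bsub>M\<^esub> m) = ?N +>\<^bsub>M\<^esub> (s \<odot>\<^bsub>M\<^esub> m)"
    if s: "s \<in> carrier S" for s
  proof -
    have "?N +>\<^bsub>M\<^esub> (s \<odot>\<^bsub>M\<^esub> x) = ?N +>\<^bsub>M\<^esub> (s \<odot>\<^bsub>M\<^esub> m)" if x: "x \<in> ?N +>\<^bsub>M\<^esub> m" for x
    proof -
      obtain n where n: "n \<in> ?N" "x = n \<oplus>\<^bsub>M\<^esub> m"
        using x unfolding a_r_coset_def' by blast
      have "s \<odot>\<^bsub>M\<^esub> x = s \<odot>\<^bsub>M\<^esub> n \<oplus>\<^bsub>M\<^esub> s \<odot>\<^bsub>M\<^esub> m"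
        unfolding n(2) using s m n(1) N(1) by (intro M.smult_r_distr) auto
      then have "s \<odot>\<^bsub>M\<^esub> x \<in> ?N +>\<^bsub>M\<^esub> (s \<odot>\<^bsub>M\<^esub> m)"
        using N(4)[OF s n(1)] unfolding a_r_coset_def' by blast
      then show ?thesis
        using M.M.a_repr_independence[OF _ _ sg, of "s \<odot>\<^bsub>M\<^esub> x" "s \<odot>\<^bsub>M\<^esub> m"] s m by simp
    qed
    moreover have "m \<in> ?N +>\<^bsub>M\<^esub> m"
      using M.add.rcos_self[OF _ sg, of m] m by (simp add: a_r_coset_def)
    ultimately have "(\<Union>x\<in>?N +>\<^bsub>M\<^esub> m. ?N +>\<^bsub>M\<^esub> (s \<odot>\<^bsub>M\<^esub> x)) = ?N +>\<^bsub>M\<^esub> (s \<odot>\<^bsub>M\<^esub> m)"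
      by (intro SUP_eq_const) blast+
    then show ?thesis
      by (simp add: quotient_module_def module_of_group_def)
  qed
  moreover have "\<zero>\<^bsub>quotient_module M ?N\<^esub> = ?N"
    by (simp add: quotient_module_def module_of_group_def A_FactGroup_def FactGroup_def)
  moreover have "?N +>\<^bsub>M\<^esub> x = ?N \<longleftrightarrow> x \<in> ?N" if "x \<in> carrier M" for x
    using M.M.a_coset_join1[OF _ that sg] M.M.a_coset_join2[OF that sg] by blast
  ultimately show ?thesis
    using m by (simp add: ann_def colon_def cong: conj_cong)
qed

lemma carrier_quotient_module:
  "carrier (quotient_module M N) = {N +>\<^bsub>M\<^esub> m | m. m \<in> carrier M}"
  by (auto simp: quotient_module_def module_of_group_def A_FactGroup_def FactGroup_def
    RCOSETS_def a_r_coset_def)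

lemma sK_quotient_iff:
  assumes "\<qq> \<subseteq> carrier R"
  shows "\<pp> \<in> sK S (quotient_module M (quot_sub \<qq>)) \<longleftrightarrow> primeideal \<pp> S \<and>
    (\<forall>I. fg_ideal I S \<and> I \<subseteq> \<pp> \<longrightarrow> (\<exists>m\<in>carrier M. I \<subseteq> colon \<qq> m \<and> colon \<qq> m \<subseteq> \<pp>))"
proof -
  let ?Q = "quotient_module M (quot_sub \<qq>)"
  have "(\<exists>z\<in>carrier ?Q. Q (ann S ?Q z)) \<longleftrightarrow> (\<exists>m\<in>carrier M. Q (colon \<qq> m))" for Q
  proof -
    have "(\<exists>z\<in>carrier ?Q. Q (ann S ?Q z)) \<longleftrightarrow>
        (\<exists>m\<in>carrier M. Q (ann S ?Q (quot_sub \<qq> +>\<^bsub>M\<^esub> m)))"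
      unfolding carrier_quotient_module by blast
    then show ?thesis by (simp add: ann_quotient_coset[OF assms])
  qed
  from this[of "\<lambda>A. _ \<subseteq> A \<and> A \<subseteq> \<pp>"] show ?thesis
    unfolding sK_def by simp
qed

text \<open>On generators, \<open>x \<otimes> \<phi> a y = a x \<otimes> y = 0\<close>.\<close>

lemma pure_in_kernel:
  assumes "\<qq> \<subseteq> carrier R" "x \<in> carrier L" "\<And>r. r \<in> \<qq> \<Longrightarrow> r \<odot>\<^bsub>L\<^esub> x = \<zero>\<^bsub>L\<^esub>" "m \<in> quot_sub \<qq>"
  shows "frag_of (x, m) \<in> T.kernel"
proof -
  have "frag_of (x, m) \<doteq> 0"
    using assms(1,4)
  proof (induction rule: quot_sub_induct)
    case zero
    then show ?case using T.pure_zero_right[of x] assms(2) by simp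
  next
    case (smult a y)
    have "frag_of (x, \<phi> a \<odot>\<^bsub>M\<^esub> y) \<doteq> frag_of (a \<odot>\<^bsub>L\<^esub> x, y)"
      using T.teq_sym[OF T.pure_smult[of a x y]] smult assms(1,2) by auto
    also have "\<dots> \<doteq> 0" using assms(3)[OF smult(1)] T.pure_zero_left smult(2) by simp
    finally show ?case .
  next
    case (add h1 h2)
    have "h1 \<in> carrier M" "h2 \<in> carrier M"
      using subgroup.subset[OF quot_sub_subgroup[OF assms(1)]] add.hyps by auto
    then have "frag_of (x, h1 \<oplus>\<^bsub>M\<^esub> h2) \<doteq> frag_of (x, h1) + frag_of (x, h2)"
      using T.pure_add_right[of x h1 h2] assms(2) by simp
    also have "\<dots> \<doteq> 0 + 0" using add.IH by (rule T.teq_add)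
    finally show ?case by simp
  qed
  then show ?thesis by (simp add: T.teq_0_iff)
qed

text \<open>By flatness \<open>m\<close> is a trivial family. Each column of its matrix is a
  relation among the \<open>x j\<close>, so its entries lie in \<open>\<qq>\<close> by
  \<open>indep\<close>, and \<open>m j\<close> is a sum of elements
  \<open>\<phi> (a j t) y t\<close> of \<open>\<qq>M\<close>.\<close>

lemma quot_sub_if_kernel:
  fixes J :: "nat set"
  assumes q: "\<qq> \<subseteq> carrier R" and fin: "finite J"
    and x: "x \<in> J \<rightarrow> carrier L" and m: "m \<in> J \<rightarrow> carrier M"
    and indep: "\<And>a j. \<lbrakk>a \<in> J \<rightarrow> carrier R; (\<Oplus>\<^bsub>L\<^esub>j\<in>J. a j \<odot>\<^bsub>L\<^esub> x j) = \<zero>\<^bsub>L\<^esub>; j \<in> J\<rbrakk> \<Longrightarrow> a j \<in> \<qq>"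
    and kernel: "(\<Sum>j\<in>J. frag_of (x j, m j)) \<in> T.kernel"
    and j: "j \<in> J"
  shows "m j \<in> quot_sub \<qq>"
proof -
  have "trivial_family R L MR J x m"
    using T.trivial_family_if_kernel_flat[OF flat fg fin x _ kernel] m by simp
  then obtain n :: nat and a y where y: "y \<in> {..<n} \<rightarrow> carrier MR"
    and a: "\<And>j t. \<lbrakk>j \<in> J; t < n\<rbrakk> \<Longrightarrow> a j t \<in> carrier R"
    and my: "\<And>j. j \<in> J \<Longrightarrow> m j = (\<Oplus>\<^bsub>MR\<^esub>t\<in>{..<n}. a j t \<odot>\<^bsub>MR\<^esub> y t)"
    and rel: "\<And>t. t < n \<Longrightarrow> (\<Oplus>\<^bsub>L\<^esub>j\<in>J. a j t \<odot>\<^bsub>L\<^esub> x j) = \<zero>\<^bsub>L\<^esub>"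
    by (rule T.trivial_familyE) blast
  have "a j t \<in> \<qq>" if "t < n" for t
    using indep[of "\<lambda>j. a j t"] a rel that j by auto
  then have "(\<lambda>t. \<phi> (a j t) \<odot>\<^bsub>M\<^esub> y t) \<in> {..<n} \<rightarrow> quot_sub \<qq>"
    using y smult_in_quot_sub by (auto simp: Pi_iff)
  from quot_sub_finsum[OF q this] show ?thesis
    using my[OF j] by simp
qed

lemma sK_quotient_subset_sK_tensor:
  assumes q: "\<qq> \<in> Ass R L"
  shows "sK S (quotient_module M (quot_sub \<qq>)) \<subseteq> sK S (tensor_module R \<phi> L M)"
proof
  fix \<pp> assume p: "\<pp> \<in> sK S (quotient_module M (quot_sub \<qq>))"
  obtain x where x: "x \<in> carrier L" "\<qq> = ann R L x"
    using q by (auto simp: Ass_def)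
  then have qR: "\<qq> \<subseteq> carrier R" by (auto simp: ann_def)
  have ann: "frag_ann (frag_of (x, m)) = colon \<qq> m" if m: "m \<in> carrier M" for m
  proof (intro subset_antisym subsetI)
    fix s assume s: "s \<in> colon \<qq> m"
    then show "s \<in> frag_ann (frag_of (x, m))"
      using pure_in_kernel[OF qR x(1)] x(2) by (auto simp: colon_def frag_ann_def ann_def)
  next
    fix s assume s: "s \<in> frag_ann (frag_of (x, m))"
    have "s \<odot>\<^bsub>M\<^esub> m \<in> quot_sub \<qq>"
      \<comment> \<open>A family with one member: independence modulo \<open>\<qq>\<close> now says
        that \<open>a x = 0\<close> forces \<open>a \<in> \<qq>\<close>, which holds because
        \<open>\<qq>\<close> is the annihilator of \<open>x\<close>.\<close>
      using quot_sub_if_kernel[OF qR, of "{0}" "\<lambda>_. x" "\<lambda>_. s \<odot>\<^bsub>M\<^esub> m" 0] s x m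
      by (auto simp: frag_ann_def ann_def Pi_iff)
    then show "s \<in> colon \<qq> m" using s by (simp add: colon_def frag_ann_def)
  qed
  show "\<pp> \<in> sK S (tensor_module R \<phi> L M)"
    unfolding sK_tensor_iff
  proof (intro conjI allI impI)
    fix I assume "fg_ideal I S \<and> I \<subseteq> \<pp>"
    then obtain m where "m \<in> carrier M" "I \<subseteq> colon \<qq> m" "colon \<qq> m \<subseteq> \<pp>"
      using p sK_quotient_iff[OF qR] by blast
    then show "\<exists>c. Poly_Mapping.keys c \<subseteq> carrier L \<times> carrier M \<and> I \<subseteq> frag_ann c \<and> frag_ann c \<subseteq> \<pp>"
      using x(1) ann by (intro exI[of _ "frag_of (x, m)"]) simp
  qed (use p sK_quotient_iff[OF qR] in blast)
qed

text \<open>The elements of \<open>Q\<close> are imposed one at a time. Each step replaces the first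
  components by linear combinations of the previous ones, so whatever killed all of them before
  still does.\<close>

lemma annihilated_representation:
  assumes "finite Q" "Q \<subseteq> carrier R" "Poly_Mapping.keys c \<subseteq> carrier L \<times> carrier M"
    and "\<phi> ` Q \<subseteq> frag_ann c"
  shows "\<exists>(n::nat) x y. x \<in> {..<n} \<rightarrow> carrier L \<and> y \<in> {..<n} \<rightarrow> carrier M \<and>
    c \<doteq> (\<Sum>j<n. frag_of (x j, y j)) \<and> (\<forall>r\<in>Q. \<forall>j<n. r \<odot>\<^bsub>L\<^esub> x j = \<zero>\<^bsub>L\<^esub>)"
  using assms(1,2,4)
proof (induction Q rule: finite_induct)
  case empty
  obtain n :: nat and x y where "x \<in> {..<n} \<rightarrow> carrier L" "y \<in> {..<n} \<rightarrow> carrier MR"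
    "c \<doteq> (\<Sum>j<n. frag_of (x j, y j))"
    by (rule T.ex_sum_pure[of c]) (use assms(3) in simp_all)
  then show ?case by (intro exI[of _ n] exI[of _ x] exI[of _ y]) simp
next
  case (insert r Q)
  then have "Q \<subseteq> carrier R" "\<phi> ` Q \<subseteq> frag_ann c" by simp_all
  from insert.IH[OF this] obtain n :: nat and x y
    where x: "x \<in> {..<n} \<rightarrow> carrier L" and y: "y \<in> {..<n} \<rightarrow> carrier M"
      and c: "c \<doteq> (\<Sum>j<n. frag_of (x j, y j))" and Q: "\<And>r j. \<lbrakk>r \<in> Q; j < n\<rbrakk> \<Longrightarrow> r \<odot>\<^bsub>L\<^esub> x j = \<zero>\<^bsub>L\<^esub>"
    by blast
  have r: "r \<in> carrier R" and QR: "Q \<subseteq> carrier R" using insert.prems by auto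
  have xj: "x j \<in> carrier L" and yj: "y j \<in> carrier M" if "j < n" for j
    using x y that by auto
  have "(\<Sum>j<n. frag_of (r \<odot>\<^bsub>L\<^esub> x j, y j)) \<doteq> (\<Sum>j<n. frag_of (x j, \<phi> r \<odot>\<^bsub>M\<^esub> y j))"
    using T.pure_smult[OF r] xj yj by (intro T.teq_sum) simp
  also have "\<dots> = act (\<phi> r) (\<Sum>j<n. frag_of (x j, y j))"
    by (simp add: act_sum)
  also have "\<dots> \<doteq> act (\<phi> r) c"
    by (rule act_cong[OF phi_closed[OF r] T.teq_sym[OF c]])
  also have "\<dots> \<doteq> 0"
    using insert.prems by (simp add: frag_ann_def T.teq_0_iff)
  finally have "(\<Sum>j<n. frag_of (r \<odot>\<^bsub>L\<^esub> x j, y j)) \<in> T.kernel"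
    by (simp add: T.teq_0_iff)
  \<comment> \<open>The vanishing criterion is applied to the multiples \<open>r x j\<close>. The
    columns of the resulting matrix are then combinations of the \<open>x j\<close> themselves that
    are killed by \<open>r\<close>; they become the new first components \<open>z\<close>.\<close>
  then have "trivial_family R L MR {..<n} (\<lambda>j. r \<odot>\<^bsub>L\<^esub> x j) y"
    using r x y by (intro T.trivial_family_if_kernel_flat[OF flat fg]) (simp_all add: Pi_iff)
  then obtain n' :: nat and a w where w: "w \<in> {..<n'} \<rightarrow> carrier MR"
    and a: "\<And>j t. \<lbrakk>j \<in> {..<n}; t < n'\<rbrakk> \<Longrightarrow> a j t \<in> carrier R"
    and yw: "\<And>j. j \<in> {..<n} \<Longrightarrow> y j = (\<Oplus>\<^bsub>MR\<^esub>t\<in>{..<n'}. a j t \<odot>\<^bsub>MR\<^esub> w t)"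
    and rel: "\<And>t. t < n' \<Longrightarrow> (\<Oplus>\<^bsub>L\<^esub>j\<in>{..<n}. a j t \<odot>\<^bsub>L\<^esub> (r \<odot>\<^bsub>L\<^esub> x j)) = \<zero>\<^bsub>L\<^esub>"
    by (rule T.trivial_familyE) blast
  define z where "z t = (\<Oplus>\<^bsub>L\<^esub>j\<in>{..<n}. a j t \<odot>\<^bsub>L\<^esub> x j)" for t
  have z: "z \<in> {..<n'} \<rightarrow> carrier L"
    unfolding z_def using a xj by (intro Pi_I L.M.finsum_closed) auto
  have smult_z: "s \<odot>\<^bsub>L\<^esub> z t = (\<Oplus>\<^bsub>L\<^esub>j\<in>{..<n}. a j t \<odot>\<^bsub>L\<^esub> (s \<odot>\<^bsub>L\<^esub> x j))"
    if "s \<in> carrier R" "t < n'" for s t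
  proof -
    have "s \<odot>\<^bsub>L\<^esub> z t = (\<Oplus>\<^bsub>L\<^esub>j\<in>{..<n}. s \<odot>\<^bsub>L\<^esub> (a j t \<odot>\<^bsub>L\<^esub> x j))"
      unfolding z_def using a xj that by (intro L.finsum_smult_ldistr) auto
    also have "\<dots> = (\<Oplus>\<^bsub>L\<^esub>j\<in>{..<n}. a j t \<odot>\<^bsub>L\<^esub> (s \<odot>\<^bsub>L\<^esub> x j))"
      using a xj that by (intro L.M.finsum_cong') (auto simp: L.smult_assoc1[symmetric] R.m_comm)
    finally show ?thesis .
  qed
  have zero: "s \<odot>\<^bsub>L\<^esub> z t = \<zero>\<^bsub>L\<^esub>" if "s \<in> insert r Q" "t < n'" for s t
  proof (cases "s = r")
    case True
    then show ?thesis using smult_z[OF r that(2)] rel[OF that(2)] by simp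
  next
    case False
    then have s: "s \<in> Q" "s \<in> carrier R" using that QR by auto
    have "(\<Oplus>\<^bsub>L\<^esub>j\<in>{..<n}. a j t \<odot>\<^bsub>L\<^esub> (s \<odot>\<^bsub>L\<^esub> x j)) = (\<Oplus>\<^bsub>L\<^esub>j\<in>{..<n}. \<zero>\<^bsub>L\<^esub>)"
      using Q[OF s(1)] a that(2) by (intro L.M.finsum_cong') auto
    then show ?thesis using smult_z[OF s(2) that(2)] by simp
  qed
  have "(\<Sum>j<n. frag_of (x j, y j))
    = (\<Sum>j<n. frag_of (x j, \<Oplus>\<^bsub>MR\<^esub>t\<in>{..<n'}. a j t \<odot>\<^bsub>MR\<^esub> w t))"
    using yw by (intro sum.cong) auto
  also have "\<dots> \<doteq> (\<Sum>t<n'. frag_of (z t, w t))"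
    unfolding z_def using a w x by (intro T.pure_sum_swap) auto
  finally have "c \<doteq> (\<Sum>t<n'. frag_of (z t, w t))"
    using T.teq_trans[OF c] by blast
  then show ?case
    using z w zero by (intro exI[of _ n'] exI[of _ z] exI[of _ w]) auto
qed

lemma frag_ann_sum:
  "frag_ann (\<Sum>j\<in>J. frag_of (x j, y j))
    = {s \<in> carrier S. (\<Sum>j\<in>J. frag_of (x j, s \<odot>\<^bsub>M\<^esub> y j)) \<in> T.kernel}"
  by (simp add: frag_ann_def act_sum)

text \<open>A product of elements taken from \<open>colon \<qq> (y j)\<close> outside
  \<open>P\<close> stays outside \<open>P\<close>, because \<open>P\<close> is prime, and moves
  every \<open>y j\<close> into \<open>\<qq>M\<close>. For empty \<open>J\<close> the unit
  serves.\<close>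

lemma ex_common_multiplier:
  assumes P: "primeideal P S" and q: "\<qq> \<subseteq> carrier R" and "finite J"
    and "y \<in> J \<rightarrow> carrier M" and "\<And>j. j \<in> J \<Longrightarrow> \<not> colon \<qq> (y j) \<subseteq> P"
  shows "\<exists>s\<in>carrier S - P. \<forall>j\<in>J. s \<odot>\<^bsub>M\<^esub> y j \<in> quot_sub \<qq>"
  using assms(3-)
proof (induction J rule: finite_induct)
  case empty
  have "\<one>\<^bsub>S\<^esub> \<notin> P"
    using ideal.one_imp_carrier[OF primeideal.axioms(1)[OF P]] primeideal.I_notcarr[OF P] by blast
  then show ?case by (intro bexI[of _ "\<one>\<^bsub>S\<^esub>"]) auto
next
  case (insert i J)
  then obtain s where s: "s \<in> carrier S - P" "\<forall>j\<in>J. s \<odot>\<^bsub>M\<^esub> y j \<in> quot_sub \<qq>" by auto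
  obtain t where t: "t \<in> carrier S" "t \<notin> P" "t \<odot>\<^bsub>M\<^esub> y i \<in> quot_sub \<qq>"
    using insert.prems(2)[of i] by (auto simp: colon_def)
  have closed: "r \<odot>\<^bsub>M\<^esub> m \<in> quot_sub \<qq>" if "r \<in> carrier S" "m \<in> quot_sub \<qq>" for r m
    using M.submoduleE(4)[OF quot_sub_submodule[OF q]] that by blast
  have "(s \<otimes>\<^bsub>S\<^esub> t) \<odot>\<^bsub>M\<^esub> y j \<in> quot_sub \<qq>" if j: "j \<in> insert i J" for j
  proof -
    have yj: "y j \<in> carrier M" using insert.prems(1) j by blast
    show ?thesis
    proof (cases "j = i")
      case True
      then show ?thesis using closed[OF _ t(3), of s] s(1) t(1) yj by (simp add: M.smult_assoc1)
    next
      case False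
      then have "t \<odot>\<^bsub>M\<^esub> (s \<odot>\<^bsub>M\<^esub> y j) \<in> quot_sub \<qq>" using closed[OF t(1)] s(2) j by blast
      then show ?thesis
        using s(1) t(1) yj M.smult_assoc1[of t s "y j"] by (simp add: S.m_comm)
    qed
  qed
  moreover have "s \<otimes>\<^bsub>S\<^esub> t \<in> carrier S - P"
    using primeideal.I_prime[OF P, of s t] s(1) t by auto
  ultimately show ?case by blast
qed

text \<open>Once the \<open>x j\<close> are linearly independent modulo \<open>\<qq>\<close>, the annihilator of \<open>\<Sum>j. x j \<otimes> y j\<close>
  is the finite intersection of the ideals \<open>colon \<qq> (y j)\<close>, so one of them lies in \<open>P\<close>. Otherwise a
  relation \<open>\<Sum>j. a j x j = 0\<close> with \<open>a k \<notin> \<qq>\<close> makes \<open>x k\<close> superfluous after multiplication with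
  \<open>\<phi> (a k) \<notin> P\<close>.\<close>

lemma frag_ann_reduction:
  fixes J :: "nat set"
  assumes P: "primeideal P S" and q: "\<qq> = {r \<in> carrier R. \<phi> r \<in> P}"
    and "finite J" "x \<in> J \<rightarrow> carrier L" "y \<in> J \<rightarrow> carrier M"
    and "\<And>r j. \<lbrakk>r \<in> \<qq>; j \<in> J\<rbrakk> \<Longrightarrow> r \<odot>\<^bsub>L\<^esub> x j = \<zero>\<^bsub>L\<^esub>"
    and "frag_ann (\<Sum>j\<in>J. frag_of (x j, y j)) \<subseteq> P"
  shows "\<exists>u\<in>carrier L. \<exists>m\<in>carrier M. ann R L u = \<qq> \<and>
    frag_ann (\<Sum>j\<in>J. frag_of (x j, y j)) \<subseteq> colon \<qq> m \<and> colon \<qq> m \<subseteq> P"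
  using assms(3-)
\<comment> \<open>An elimination changes the second components, hence \<open>arbitrary: y\<close>;
  the first components are only discarded.\<close>
proof (induction J arbitrary: y rule: finite_psubset_induct)
  case (psubset J)
  let ?e = "\<Sum>j\<in>J. frag_of (x j, y j)"
  have fin: "finite J" by fact
  have x: "x \<in> J \<rightarrow> carrier L" and y: "y \<in> J \<rightarrow> carrier M" by fact+
  have xj: "x j \<in> carrier L" and yj: "y j \<in> carrier M" if "j \<in> J" for j
    using x y that by auto
  have qR: "\<qq> \<subseteq> carrier R" using q by auto
  show ?case
  proof (cases "\<forall>a. a \<in> J \<rightarrow> carrier R \<longrightarrow> (\<Oplus>\<^bsub>L\<^esub>j\<in>J. a j \<odot>\<^bsub>L\<^esub> x j) = \<zero>\<^bsub>L\<^esub> \<longrightarrow> (\<forall>j\<in>J. a j \<in> \<qq>)")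
    case True
    then have indep: "a j \<in> \<qq>"
      if "a \<in> J \<rightarrow> carrier R" "(\<Oplus>\<^bsub>L\<^esub>j\<in>J. a j \<odot>\<^bsub>L\<^esub> x j) = \<zero>\<^bsub>L\<^esub>" "j \<in> J" for a j
      using that by blast
    have "\<exists>k\<in>J. colon \<qq> (y k) \<subseteq> P"
    \<comment> \<open>Otherwise a single \<open>s\<close> outside \<open>P\<close> moves all
      \<open>y j\<close> into \<open>\<qq>M\<close>. As \<open>\<qq>\<close> kills the
      \<open>x j\<close>, this \<open>s\<close> kills the whole tensor, against the assumption that
      its annihilator lies in \<open>P\<close>.\<close>
    proof (rule ccontr)
      assume "\<not> ?thesis"
      then obtain s where s: "s \<in> carrier S - P" "\<forall>j\<in>J. s \<odot>\<^bsub>M\<^esub> y j \<in> quot_sub \<qq>"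
        using ex_common_multiplier[OF P qR fin y] by blast
      have "(\<Sum>j\<in>J. frag_of (x j, s \<odot>\<^bsub>M\<^esub> y j)) \<doteq> (\<Sum>j\<in>J. 0)"
        using s psubset.prems(3) xj pure_in_kernel[OF qR]
        by (intro T.teq_sum) (simp add: T.teq_0_iff)
      then have "s \<in> frag_ann ?e" using s by (simp add: frag_ann_sum T.teq_0_iff)
      then show False using psubset.prems(4) s by blast
    qed
    then obtain k where k: "k \<in> J" "colon \<qq> (y k) \<subseteq> P" by blast
    have "frag_ann ?e \<subseteq> colon \<qq> (y k)"
    proof
      fix s assume "s \<in> frag_ann ?e"
      then have s: "s \<in> carrier S" "(\<Sum>j\<in>J. frag_of (x j, s \<odot>\<^bsub>M\<^esub> y j)) \<in> T.kernel"
        by (simp_all add: frag_ann_sum)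
      have "s \<odot>\<^bsub>M\<^esub> y k \<in> quot_sub \<qq>"
      proof (rule quot_sub_if_kernel[OF qR fin x, where m = "\<lambda>j. s \<odot>\<^bsub>M\<^esub> y j" and j = k])
        show "a j \<in> \<qq>"
          if "a \<in> J \<rightarrow> carrier R" "(\<Oplus>\<^bsub>L\<^esub>j\<in>J. a j \<odot>\<^bsub>L\<^esub> x j) = \<zero>\<^bsub>L\<^esub>" "j \<in> J" for a j
          by (rule indep[OF that])
      qed (use s yj k(1) in auto)
      then show "s \<in> colon \<qq> (y k)" using s(1) by (simp add: colon_def)
    qed
    moreover have "ann R L (x k) = \<qq>"
    proof (intro subset_antisym subsetI)
      fix r assume "r \<in> ann R L (x k)"
      then have r: "r \<in> carrier R" "r \<odot>\<^bsub>L\<^esub> x k = \<zero>\<^bsub>L\<^esub>" by (simp_all add: ann_def)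
      \<comment> \<open>An annihilator of \<open>x k\<close> is a linear relation with one possibly
        nonzero coefficient, to which independence applies.\<close>
      then have "(\<Oplus>\<^bsub>L\<^esub>j\<in>J. (if j = k then r else \<zero>\<^bsub>R\<^esub>) \<odot>\<^bsub>L\<^esub> x j) = \<zero>\<^bsub>L\<^esub>"
        using L.finsum_delta[OF fin k(1) x r(1)] by simp
      then show "r \<in> \<qq>"
        using indep[of "\<lambda>j. if j = k then r else \<zero>\<^bsub>R\<^esub>" k] r(1) k(1) by simp
    next
      fix r assume "r \<in> \<qq>"
      then show "r \<in> ann R L (x k)" using psubset.prems(3) k(1) qR by (auto simp: ann_def)
    qed
    ultimately show ?thesis using k xj yj by blast
  next
    case False
    then obtain a k where a: "a \<in> J \<rightarrow> carrier R" "(\<Oplus>\<^bsub>L\<^esub>j\<in>J. a j \<odot>\<^bsub>L\<^esub> x j) = \<zero>\<^bsub>L\<^esub>"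
      and k: "k \<in> J" "a k \<notin> \<qq>" by blast
    have aj: "a j \<in> carrier R" if "j \<in> J" for j using a(1) that by blast
    let ?b = "\<phi> (a k)"
    have b: "?b \<in> carrier S" "?b \<notin> P" using k aj q by auto
    \<comment> \<open>The tensor \<open>(\<Sum>j. a j x j) \<otimes> y k\<close>, which is zero, is
      subtracted from \<open>\<phi> (a k)\<close> times the given one. The component at
      \<open>k\<close> then cancels, and index \<open>k\<close> can be removed.\<close>
    define y' where "y' j = ?b \<odot>\<^bsub>M\<^esub> y j \<oplus>\<^bsub>M\<^esub> \<ominus>\<^bsub>M\<^esub> (\<phi> (a j) \<odot>\<^bsub>M\<^esub> y k)" for j
    have y': "y' j \<in> carrier M" if "j \<in> J" for j
      using that b aj yj k(1) by (simp add: y'_def)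
    let ?e' = "\<Sum>j\<in>J - {k}. frag_of (x j, y' j)"
    have "(\<Sum>j\<in>J. frag_of (x j, \<phi> (a j) \<odot>\<^bsub>M\<^esub> y k)) \<doteq> (\<Sum>j\<in>J. frag_of (a j \<odot>\<^bsub>L\<^esub> x j, y k))"
    proof (rule T.teq_sum)
      fix j assume "j \<in> J"
      then show "frag_of (x j, \<phi> (a j) \<odot>\<^bsub>M\<^esub> y k) \<doteq> frag_of (a j \<odot>\<^bsub>L\<^esub> x j, y k)"
        using T.teq_sym[OF T.pure_smult[of "a j" "x j" "y k"]] aj xj yj k(1) by simp
    qed
    also have "\<dots> \<doteq> frag_of (\<Oplus>\<^bsub>L\<^esub>j\<in>J. a j \<odot>\<^bsub>L\<^esub> x j, y k)"
      using fin aj xj yj k(1) by (intro T.teq_sym[OF T.pure_sum_left]) auto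
    also have "\<dots> \<doteq> 0"
      unfolding a(2) using yj k(1) by (intro T.pure_zero_left) simp
    finally have rel: "(\<Sum>j\<in>J. frag_of (x j, \<phi> (a j) \<odot>\<^bsub>M\<^esub> y k)) \<doteq> 0" .
    have "y' k = \<zero>\<^bsub>M\<^esub>" using b yj k(1) by (simp add: y'_def M.M.r_neg)
    then have "?e' + 0 \<doteq> ?e' + frag_of (x k, y' k)"
      using T.teq_sym[OF T.pure_zero_right[of "x k"]] xj k(1) by (intro T.teq_add) simp_all
    also have "\<dots> = (\<Sum>j\<in>J. frag_of (x j, y' j))"
      using fin k(1) by (simp add: sum.remove add.commute)
    also have "\<dots> \<doteq> (\<Sum>j\<in>J. frag_of (x j, ?b \<odot>\<^bsub>M\<^esub> y j) - frag_of (x j, \<phi> (a j) \<odot>\<^bsub>M\<^esub> y k))"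
    proof (rule T.teq_sum)
      fix j assume j: "j \<in> J"
      have cl: "?b \<odot>\<^bsub>M\<^esub> y j \<in> carrier M" "\<phi> (a j) \<odot>\<^bsub>M\<^esub> y k \<in> carrier M"
        using j b aj yj k(1) by auto
      have "frag_of (x j, y' j)
          \<doteq> frag_of (x j, ?b \<odot>\<^bsub>M\<^esub> y j) + frag_of (x j, \<ominus>\<^bsub>M\<^esub> (\<phi> (a j) \<odot>\<^bsub>M\<^esub> y k))"
        using T.pure_add_right[of "x j" "?b \<odot>\<^bsub>M\<^esub> y j" "\<ominus>\<^bsub>M\<^esub> (\<phi> (a j) \<odot>\<^bsub>M\<^esub> y k)"] xj[OF j] cl
        by (simp add: y'_def)
      also have "\<dots> \<doteq> frag_of (x j, ?b \<odot>\<^bsub>M\<^esub> y j) + - frag_of (x j, \<phi> (a j) \<odot>\<^bsub>M\<^esub> y k)"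
        using T.pure_minus_right[of "x j" "\<phi> (a j) \<odot>\<^bsub>M\<^esub> y k"] xj[OF j] cl
        by (intro T.teq_add) simp_all
      finally show "frag_of (x j, y' j)
          \<doteq> frag_of (x j, ?b \<odot>\<^bsub>M\<^esub> y j) - frag_of (x j, \<phi> (a j) \<odot>\<^bsub>M\<^esub> y k)"
        by simp
    qed
    also have "\<dots> = (\<Sum>j\<in>J. frag_of (x j, ?b \<odot>\<^bsub>M\<^esub> y j)) - (\<Sum>j\<in>J. frag_of (x j, \<phi> (a j) \<odot>\<^bsub>M\<^esub> y k))"
      by (rule sum_subtractf)
    also have "\<dots> \<doteq> (\<Sum>j\<in>J. frag_of (x j, ?b \<odot>\<^bsub>M\<^esub> y j)) - 0"
      using rel by (intro T.teq_diff T.teq_refl)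
    finally have e': "?e' \<doteq> (\<Sum>j\<in>J. frag_of (x j, ?b \<odot>\<^bsub>M\<^esub> y j))" by simp
    \<comment> \<open>Since \<open>?e'\<close> represents \<open>?b\<close> times \<open>?e\<close>,
      its annihilator is the colon ideal of \<open>frag_ann ?e\<close> by \<open>?b\<close>. As
      \<open>?b\<close> is outside the prime \<open>P\<close>, it stays inside
      \<open>P\<close>.\<close>
    have ann_e': "s \<in> frag_ann ?e' \<longleftrightarrow> s \<in> carrier S \<and> s \<otimes>\<^bsub>S\<^esub> ?b \<in> frag_ann ?e" for s
    proof -
      have "(\<Sum>j\<in>J. frag_of (x j, s \<odot>\<^bsub>M\<^esub> (?b \<odot>\<^bsub>M\<^esub> y j)))
          = (\<Sum>j\<in>J. frag_of (x j, (s \<otimes>\<^bsub>S\<^esub> ?b) \<odot>\<^bsub>M\<^esub> y j))" if "s \<in> carrier S"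
        using that b(1) yj by (intro sum.cong) (simp_all add: M.smult_assoc1)
      then show ?thesis
        using b(1) by (subst frag_ann_cong[OF e']) (auto simp: frag_ann_sum)
    qed
    have "frag_ann ?e' \<subseteq> P"
    proof
      fix s assume "s \<in> frag_ann ?e'"
      then have "s \<in> carrier S" "s \<otimes>\<^bsub>S\<^esub> ?b \<in> P" using ann_e' psubset.prems(4) by auto
      then show "s \<in> P" using primeideal.I_prime[OF P, of s ?b] b by blast
    qed
    moreover have "J - {k} \<subset> J" "x \<in> J - {k} \<rightarrow> carrier L" "y' \<in> J - {k} \<rightarrow> carrier M"
      using k(1) xj y' by auto
    ultimately obtain u m where um: "u \<in> carrier L" "m \<in> carrier M" "ann R L u = \<qq>"
      "frag_ann ?e' \<subseteq> colon \<qq> m" "colon \<qq> m \<subseteq> P"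
      using psubset.IH[of "J - {k}" y'] psubset.prems(3) by blast
    \<comment> \<open>Passing to a multiple can only enlarge the annihilator, so the lower bound
      survives the elimination.\<close>
    have "frag_ann ?e \<subseteq> frag_ann ?e'"
    proof
      fix s assume s: "s \<in> frag_ann ?e"
      then have sS: "s \<in> carrier S" by (simp add: frag_ann_def)
      have "act ?b (act s ?e) \<in> T.kernel"
        using s act_kernel[OF b(1)] by (simp add: frag_ann_def)
      also have "act ?b (act s ?e) = act (s \<otimes>\<^bsub>S\<^esub> ?b) ?e"
        unfolding act_sum using sS b(1) yj
        by (intro sum.cong) (simp_all add: M.smult_assoc1[symmetric] S.m_comm)
      finally show "s \<in> frag_ann ?e'"
        unfolding ann_e' using sS b(1) by (simp add: frag_ann_def)
    qed
    then show ?thesis using um by blast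
  qed
qed

lemma sK_tensor_subset:
  assumes noeth: "noetherian_ring R" and P: "P \<in> sK S (tensor_module R \<phi> L M)"
  shows "\<exists>\<qq>\<in>Ass R L. P \<in> sK S (quotient_module M (quot_sub \<qq>))"
proof -
  define \<qq> where "\<qq> = {r \<in> carrier R. \<phi> r \<in> P}"
  have prime: "primeideal P S" using P by (simp add: sK_def)
  have idealP: "ideal P S" by (rule primeideal.axioms(1)[OF prime])
  have ring_hom: "ring_hom_ring R S \<phi>"
    by (rule ring_hom_ringI2[OF R.ring_axioms S.ring_axioms hom])
  have primeq: "primeideal \<qq> R"
    unfolding \<qq>_def by (rule ring_hom_ring.primeideal_vimage[OF ring_hom R.is_cring prime])
  have qR: "\<qq> \<subseteq> carrier R" by (auto simp: \<qq>_def)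
  obtain A where A: "A \<subseteq> carrier R" "finite A" "\<qq> = Idl\<^bsub>R\<^esub> A"
    using noetherian_ring.finetely_gen[OF noeth primeideal.axioms(1)[OF primeq]] by blast
  have Aq: "A \<subseteq> \<qq>" using R.genideal_self[OF A(1)] A(3) by simp
  \<comment> \<open>The elements \<open>u\<close> and \<open>m\<close> may vary with
    \<open>I\<close>, but \<open>\<qq>\<close> was fixed from \<open>P\<close> beforehand. Hence the
    \<open>m\<close> for all \<open>I\<close> test one and the same quotient
    \<open>M/\<qq>M\<close>.\<close>
  have main: "\<exists>u\<in>carrier L. \<exists>m\<in>carrier M. ann R L u = \<qq> \<and> I \<subseteq> colon \<qq> m \<and> colon \<qq> m \<subseteq> P"
    if I: "fg_ideal I S" "I \<subseteq> P" for I
  proof -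
    obtain B where B: "finite B" "B \<subseteq> carrier S" "I = Idl\<^bsub>S\<^esub> B"
      using I(1) by (auto simp: fg_ideal_def)
    let ?B = "B \<union> \<phi> ` A"
    have BS: "?B \<subseteq> carrier S" using B(2) A(1) by auto
    have "?B \<subseteq> P"
      using S.genideal_self[OF B(2)] B(3) I(2) Aq by (auto simp: \<qq>_def)
    then have "Idl\<^bsub>S\<^esub> ?B \<subseteq> P" by (rule S.genideal_minimal[OF idealP])
    moreover have "fg_ideal (Idl\<^bsub>S\<^esub> ?B) S"
      unfolding fg_ideal_def using B(1) A(2) BS by (intro exI[of _ ?B]) auto
    ultimately obtain c where c: "Poly_Mapping.keys c \<subseteq> carrier L \<times> carrier M"
      "Idl\<^bsub>S\<^esub> ?B \<subseteq> frag_ann c" "frag_ann c \<subseteq> P"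
      using P unfolding sK_tensor_iff by blast
    have sub: "?B \<subseteq> Idl\<^bsub>S\<^esub> ?B" by (rule S.genideal_self[OF BS])
    have "I \<subseteq> Idl\<^bsub>S\<^esub> ?B"
      unfolding B(3) using sub by (intro S.genideal_minimal S.genideal_ideal BS) auto
    then have Ic: "I \<subseteq> frag_ann c" using c(2) by blast
    have "\<phi> ` A \<subseteq> frag_ann c" using sub c(2) by blast
    from annihilated_representation[OF A(2,1) c(1) this] obtain n :: nat and x y
      where x: "x \<in> {..<n} \<rightarrow> carrier L" and y: "y \<in> {..<n} \<rightarrow> carrier M"
        and cxy: "c \<doteq> (\<Sum>j<n. frag_of (x j, y j))"
        and Ax: "\<And>r j. \<lbrakk>r \<in> A; j < n\<rbrakk> \<Longrightarrow> r \<odot>\<^bsub>L\<^esub> x j = \<zero>\<^bsub>L\<^esub>"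
      by blast
    \<comment> \<open>Only the generators \<open>A\<close> were imposed; all of \<open>\<qq>\<close>
      follows since the annihilator of \<open>x j\<close> is an ideal.\<close>
    have qx: "r \<odot>\<^bsub>L\<^esub> x j = \<zero>\<^bsub>L\<^esub>" if "r \<in> \<qq>" "j \<in> {..<n}" for r j
    proof -
      have "x j \<in> carrier L" using x that(2) by blast
      then have "Idl\<^bsub>R\<^esub> A \<subseteq> ann R L (x j)"
        using Ax that(2) A(1) by (intro R.genideal_minimal L.ann_ideal) (auto simp: ann_def)
      then show ?thesis using that(1) A(3) by (auto simp: ann_def)
    qed
    show ?thesis
      using frag_ann_reduction[OF prime \<qq>_def finite_lessThan x y qx] c(3) Ic
      unfolding frag_ann_cong[OF cxy] by blast
  qed
  \<comment> \<open>The zero ideal serves as a test ideal contained in every prime; from this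
    instance only the element \<open>u\<close> with annihilator \<open>\<qq>\<close> is
    kept.\<close>
  have zero: "fg_ideal (Idl\<^bsub>S\<^esub> {}) S" by (auto simp: fg_ideal_def)
  have "Idl\<^bsub>S\<^esub> {} \<subseteq> P" by (rule S.genideal_minimal[OF idealP]) simp
  from main[OF zero this] have "\<qq> \<in> Ass R L"
    using primeq by (auto simp: Ass_def)
  moreover have "P \<in> sK S (quotient_module M (quot_sub \<qq>))"
    unfolding sK_quotient_iff[OF qR] using prime main by blast
  ultimately show ?thesis by blast
qed

end

theorem theorem4p6:
  fixes R :: "('r, 'a) ring_scheme"
    and S :: "('s, 'b) ring_scheme"
    and \<phi> :: "'r \<Rightarrow> 's"
    and L :: "('r, 'l, 'c) module_scheme"
    and M :: "('s, 'm, 'd) module_scheme"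
  assumes "cring R" and "cring S" and "\<phi> \<in> ring_hom R S"
    and "module R L" and "module S M"
    and "flat_module R (restrict_scalars \<phi> M)"
    and "noetherian_ring R"
    and "fg_module R L"
  shows "sK S (tensor_module R \<phi> L M) =
    (\<Union>\<pp>\<in>Ass R L. sK S (quotient_module M (ideal_smult \<pp> (restrict_scalars \<phi> M))))"
proof -
  interpret flat_extension R S \<phi> L M
    using assms by (intro flat_extension.intro flat_extension_axioms.intro)
  show ?thesis
    using sK_tensor_subset[OF assms(7)] sK_quotient_subset_sK_tensor by blast
qed

end
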